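(* Let $K,M\in\mathbb{R}^{n\times n}$ with $K$ symmetric positive semi-definite and $M$ symmetric positive definite, and let $$H=\begin{bmatrix} O & K \\ M & O\end{bmatrix}\in\mathbb{R}^{2n\times 2n}.$$ Suppose $\dim(\mathcal{N}(H))=r>0$. Then there exist vectors $x_1^0,\dots,x_r^0,\;y_1^0,\dots,y_r^0,\;x_1,\dots,x_{n-r},\;y_1,\dots,y_{n-r}\in\mathbb{R}^n$ such that $$\mathbb{R}^{2n}=\mathcal{V}_0\oplus\mathcal{V}_1\oplus\cdots\oplus\mathcal{V}_{n-r},$$ where $$\mathcal{V}_0=\mathrm{span}\left\{\begin{bmatrix}\mathbf{0} \\ x_1^0\end{bmatrix},\dots,\begin{bmatrix}\mathbf{0} \\ x_r^0\end{bmatrix},\begin{bmatrix}y_1^0 \\ \mathbf{0}\end{bmatrix},\dots,\begin{bmatrix}y_r^0 \\ \mathbf{0}\end{bmatrix}\right\},\qquad \mathcal{V}_i=\mathrm{span}\left\{\begin{bmatrix}\mathbf{0} \\ x_i\end{bmatrix},\begin{bmatrix}y_i \\ \mathbf{0}\end{bmatrix}\right\},\quad i=1,\dots,n-r,$$ are invariant subspaces of $H$ satisfying $$H\begin{bmatrix}\mathbf{0} \\ x_i^0\end{bmatrix}=\begin{bmatrix}\mathbf{0} \\ \mathbf{0}\end{bmatrix},\qquad H\begin{bmatrix}y_i^0 \\ \mathbf{0}\end{bmatrix}=\begin{bmatrix}\mathbf{0} \\ x_i^0\end{bmatrix},\qquad i=1,\dots,r,$$ and $$H\begin{bmatrix}y_i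 \\ x_i\end{bmatrix}=\lambda_i\begin{bmatrix}y_i \\ x_i\end{bmatrix},\qquad H\begin{bmatrix}-y_i \\ x_i\end{bmatrix}=-\lambda_i\begin{bmatrix}-y_i \\ x_i\end{bmatrix},\qquad i=1,\dots,n-r,$$ where $0<\lambda_1\le\lambda_2\le\cdots\le\lambda_{n-r}$ are all the positive eigenvalues of $H$ (listed with multiplicity). Moreover, the biorthogonal property $$[x_1^0,\dots,x_r^0,x_1,\dots,x_{n-r}]^{\top}[y_1^0,\dots,y_r^0,y_1,\dots,y_{n-r}]=I_n$$ holds, i.e., $\mathcal{V}_i$ and $\mathcal{V}_j$ are biorthogonal for all $i\neq j$.
   Context: $\mathcal{N}(\cdot)$ denotes the nullspace of a matrix, $O$ a zero matrix, $\mathbf{0}$ a zero vector, and $I_n$ the $n\times n$ identity matrix. Vectors of $\mathbb{R}^{2n}$ are written in block form $\begin{bmatrix}y \\ x\end{bmatrix}$ with $x,y\in\mathbb{R}^n$. Two vectors $\begin{bmatrix}y \\ x\end{bmatrix}$ and $\begin{bmatrix}z \\ w\end{bmatrix}$ of $\mathbb{R}^{2n}$ (with $x,y,z,w\in\mathbb{R}^n$) are called biorthogonal to each other if $y^{\top}w=z^{\top}x=0$. Two subspaces $\mathcal{V},\mathcal{W}\subset\mathbb{R}^{2n}$ are biorthogonal if every $\xi\in\mathcal{V}$ is biorthogonal to every $\eta\in\mathcal{W}$. *)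

theory Defs
  imports "Jordan_Normal_Form.Matrix_Kernel" "Jordan_Normal_Form.Char_Poly"
begin

definition pos_semidef :: "nat \<Rightarrow> real mat \<Rightarrow> bool" where
  "pos_semidef n A \<longleftrightarrow> (\<forall>v \<in> carrier_vec n. v \<bullet> (A *\<^sub>v v) \<ge> 0)"

definition pos_def :: "nat \<Rightarrow> real mat \<Rightarrow> bool" where
  "pos_def n A \<longleftrightarrow> (\<forall>v \<in> carrier_vec n. v \<noteq> 0\<^sub>v n \<longrightarrow> v \<bullet> (A *\<^sub>v v) > 0)"

definition block_H :: "nat \<Rightarrow> real mat \<Rightarrow> real mat \<Rightarrow> real mat" where
  "block_H n K M = four_block_mat (0\<^sub>m n n) K M (0\<^sub>m n n)"

abbreviation span_vec :: "nat \<Rightarrow> real vec set \<Rightarrow> real vec set" where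
  "span_vec N S \<equiv> LinearCombinations.module.span class_ring (module_vec TYPE(real) N) S"

abbreviation subspace_vec :: "nat \<Rightarrow> real vec set \<Rightarrow> bool" where
  "subspace_vec N W \<equiv> VectorSpace.subspace class_ring W (module_vec TYPE(real) N)"

definition invariant_subspace :: "nat \<Rightarrow> real mat \<Rightarrow> real vec set \<Rightarrow> bool" where
  "invariant_subspace N A W \<longleftrightarrow> subspace_vec N W \<and> (\<forall>v \<in> W. A *\<^sub>v v \<in> W)"

text \<open>The whole space \<open>carrier_vec N\<close> is the internal direct sum of the subspaces
  \<open>V i\<close>, \<open>i \<in> I\<close> (with \<open>I\<close> finite). Component families are taken in the extensional
  product, so that uniqueness concerns only indices in \<open>I\<close>.\<close>

definition is_direct_sum :: "nat \<Rightarrow> nat set \<Rightarrow> (nat \<Rightarrow> real vec set) \<Rightarrow> bool" where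
  "is_direct_sum N I V \<longleftrightarrow>
     (\<forall>i \<in> I. subspace_vec N (V i)) \<and>
     (\<forall>v \<in> carrier_vec N. \<exists>!w. w \<in> (\<Pi>\<^sub>E i\<in>I. V i) \<and> v = finsum_vec TYPE(real) N w I)"

text \<open>A vector of length \<open>n + n\<close> is read as \<open>y @\<^sub>v x\<close>, with first block \<open>y\<close> and
  second block \<open>x\<close>.\<close>

definition biorthogonal :: "nat \<Rightarrow> real vec \<Rightarrow> real vec \<Rightarrow> bool" where
  "biorthogonal n \<xi> \<eta> \<longleftrightarrow>
     vec_first \<xi> n \<bullet> vec_last \<eta> n = 0 \<and> vec_first \<eta> n \<bullet> vec_last \<xi> n = 0"

definition biorthogonal_spaces :: "nat \<Rightarrow> real vec set \<Rightarrow> real vec set \<Rightarrow> bool" where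
  "biorthogonal_spaces n V W \<longleftrightarrow> (\<forall>\<xi> \<in> V. \<forall>\<eta> \<in> W. biorthogonal n \<xi> \<eta>)"

definition V_space :: "nat \<Rightarrow> nat \<Rightarrow> (nat \<Rightarrow> real vec) \<Rightarrow> (nat \<Rightarrow> real vec) \<Rightarrow>
    (nat \<Rightarrow> real vec) \<Rightarrow> (nat \<Rightarrow> real vec) \<Rightarrow> nat \<Rightarrow> real vec set" where
  "V_space n r x0 y0 x y i =
     (if i = 0
      then span_vec (n + n) ((\<lambda>j. 0\<^sub>v n @\<^sub>v x0 j) ` {1..r} \<union> (\<lambda>j. y0 j @\<^sub>v 0\<^sub>v n) ` {1..r})
      else span_vec (n + n) {0\<^sub>v n @\<^sub>v x i, y i @\<^sub>v 0\<^sub>v n})"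

text \<open>The family \<open>lam 1 \<le> \<dots> \<le> lam m\<close> lists all positive eigenvalues of \<open>A\<close>, each repeated
  according to its algebraic multiplicity. The qualified name is needed for the order of a
  polynomial at a root, since \<open>order\<close> alone also denotes the order of a group.\<close>

definition lists_pos_eigenvalues :: "real mat \<Rightarrow> nat \<Rightarrow> (nat \<Rightarrow> real) \<Rightarrow> bool" where
  "lists_pos_eigenvalues A m lam \<longleftrightarrow>
     mono_on {1..m} lam \<and>
     lam ` {1..m} = {\<mu>. eigenvalue A \<mu> \<and> 0 < \<mu>} \<and>
     (\<forall>\<mu> > 0. card {i \<in> {1..m}. lam i = \<mu>} = Polynomial.order \<mu> (char_poly A))"

definition cols_mat :: "nat \<Rightarrow> nat \<Rightarrow> nat \<Rightarrow> (nat \<Rightarrow> real vec) \<Rightarrow> (nat \<Rightarrow> real vec) \<Rightarrow> real mat" where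
  "cols_mat n r m a b = mat_of_cols n (map a [1..<Suc r] @ map b [1..<Suc m])"

end

theory Submission
  imports Defs "HOL-Computational_Algebra.Fundamental_Theorem_Algebra"
begin

text \<open>
  The matrix \<open>K M\<close> is self-adjoint for the inner product \<open>u\<^sup>T M v\<close>, so it has an
  \<open>M\<close>-orthonormal eigenbasis \<open>u\<^sub>j\<close> with eigenvalues \<open>\<mu>\<^sub>j \<ge> 0\<close>. Its existence is purely
  algebraic: if \<open>p\<close> is a nonzero real polynomial of least degree with \<open>p(A) w = 0\<close>, a factor
  \<open>(t - a)\<^sup>2 + b\<^sup>2\<close> with \<open>b \<noteq> 0\<close> would act injectively, so \<open>p\<close> has a real root and the
  complementary factor sends \<open>w\<close> to an eigenvector in any given invariant subspace containing \<open>w\<close>.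

  The families \<open>p\<^sub>j = c\<^sub>j u\<^sub>j\<close> and \<open>q\<^sub>j = c\<^sub>j\<^sup>-\<^sup>1 M u\<^sub>j\<close> are dual bases, with
  \<open>c\<^sub>j = 1\<close> when \<open>\<mu>\<^sub>j = 0\<close> and \<open>c\<^sub>j\<^sup>4 = \<mu>\<^sub>j\<close> otherwise; they are the \<open>y\<close>- and \<open>x\<close>-vectors of
  the theorem. In the basis \<open>(p\<^sub>j, 0), (0, q\<^sub>j)\<close> everything is read off from coordinates, and
  \<open>H\<close> has characteristic polynomial \<open>\<Prod>\<^sub>j (t\<^sup>2 - \<mu>\<^sub>j)\<close>.
\<close>

section \<open>Eigenvectors of self-adjoint matrices\<close>

text \<open>Fewer than \<open>n\<close> orthogonality conditions are the rows of an \<open>n\<close>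
  by \<open>n\<close> matrix that still has room for a zero row. Such a matrix is singular, and any
  nonzero kernel vector serves as \<open>w\<close>.\<close>

lemma exists_nonzero_orthogonal:
  fixes f :: "nat \<Rightarrow> 'a :: field vec"
  assumes "k < n" and f: "\<And>i. i < k \<Longrightarrow> f i \<in> carrier_vec n"
  obtains w where "w \<in> carrier_vec n" "w \<noteq> 0\<^sub>v n" "\<And>i. i < k \<Longrightarrow> f i \<bullet> w = 0"
proof -
  \<comment> \<open>The default makes every row a vector of length \<open>n\<close>, also beyond
    index \<open>k\<close>; the zero row at \<open>k\<close> alone forces the determinant to
    vanish.\<close>
  define c where "c i = (if i < k then f i else 0\<^sub>v n)" for i
  define A where "A = mat\<^sub>r n n (\<lambda>i. if i = k then 0\<^sub>v n else c i)"
  have A: "A \<in> carrier_mat n n" by (simp add: A_def)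
  have "det A = 0"
    unfolding A_def using assms by (intro det_row_0) (auto simp: c_def)
  then obtain w where w: "w \<in> carrier_vec n" "w \<noteq> 0\<^sub>v n" "A *\<^sub>v w = 0\<^sub>v n"
    using det_0_iff_vec_prod_zero_field[OF A] by auto
  have "f i \<bullet> w = 0" if "i < k" for i
  proof -
    have "row A i = f i"
      using that assms f[OF that] by (intro eq_vecI) (auto simp: A_def c_def)
    moreover have "(A *\<^sub>v w) $ i = 0"
      using w(3) that assms by simp
    ultimately show ?thesis
      using that assms A by simp
  qed
  with w that show ?thesis by blast
qed

text \<open>This is \<open>p(A) w\<close> by Horner's scheme: only matrix-vector products occur, and
  induction along \<open>pCons\<close> applies directly.\<close>

definition poly_act :: "'a :: field mat \<Rightarrow> 'a poly \<Rightarrow> 'a vec \<Rightarrow> 'a vec" where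
  "poly_act A p w = fold_coeffs (\<lambda>a v. a \<cdot>\<^sub>v w + A *\<^sub>v v) p (0\<^sub>v (dim_vec w))"

context
  fixes A :: "'a :: field mat" and n :: nat and w :: "'a vec"
  assumes A: "A \<in> carrier_mat n n" and w: "w \<in> carrier_vec n"
begin

lemma mult_A_carrier: "v \<in> carrier_vec n \<Longrightarrow> A *\<^sub>v v \<in> carrier_vec n"
  using A by (rule mult_mat_vec_carrier)

lemma mult_A_zero: "A *\<^sub>v 0\<^sub>v n = 0\<^sub>v n"
  using A by (intro eq_vecI) auto

lemma poly_act_0: "poly_act A 0 w = 0\<^sub>v n"
  using w by (auto simp: poly_act_def)

lemma poly_act_pCons: "poly_act A (pCons a p) w = a \<cdot>\<^sub>v w + A *\<^sub>v poly_act A p w"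
proof (cases "p = 0 \<and> a = 0")
  case True
  then show ?thesis using w by (auto simp: poly_act_0 mult_A_zero intro!: eq_vecI)
next
  case False
  then show ?thesis by (auto simp: poly_act_def fold_coeffs_pCons_not_0_0_eq fold_coeffs_pCons_coeff_not_0_eq)
qed

text \<open>This keeps an eigenvector of the form \<open>p(A) w\<close> inside a given invariant
  subspace that contains \<open>w\<close>.\<close>

lemma poly_act_closed:
  assumes "w \<in> W" "W \<subseteq> carrier_vec n" "0\<^sub>v n \<in> W"
    and "\<And>u v. u \<in> W \<Longrightarrow> v \<in> W \<Longrightarrow> u + v \<in> W"
    and "\<And>a v. v \<in> W \<Longrightarrow> a \<cdot>\<^sub>v v \<in> W"
    and "\<And>v. v \<in> W \<Longrightarrow> A *\<^sub>v v \<in> W"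
  shows "poly_act A p w \<in> W"
  by (induction p) (use assms in \<open>auto simp: poly_act_0 poly_act_pCons\<close>)

lemma poly_act_carrier: "poly_act A p w \<in> carrier_vec n"
  by (rule poly_act_closed) (auto simp: w mult_A_carrier)

lemma poly_act_add: "poly_act A (p + q) w = poly_act A p w + poly_act A q w"
proof (induction p q rule: poly_induct2)
  case (pCons a p b q)
  have "(x + y) + (u + v) = (x + u) + (y + v)"
    if "x \<in> carrier_vec n" "y \<in> carrier_vec n" "u \<in> carrier_vec n" "v \<in> carrier_vec n" for x y u v :: "'a vec"
    using that by (intro eq_vecI) auto
  with pCons w show ?case
    by (simp add: poly_act_pCons mult_add_distrib_mat_vec[OF A] poly_act_carrier add_smult_distrib_vec mult_A_carrier)
qed (simp add: poly_act_0)

lemma poly_act_smult: "poly_act A (smult c p) w = c \<cdot>\<^sub>v poly_act A p w"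
proof (induction p)
  case (pCons a p)
  then show ?case
    using w by (simp add: poly_act_pCons mult_mat_vec[OF A] poly_act_carrier smult_add_distrib_vec[of _ n]
        smult_smult_assoc mult_A_carrier)
qed (auto simp: poly_act_0)

lemma poly_act_pCons_0: "poly_act A (pCons 0 p) w = A *\<^sub>v poly_act A p w"
  proof -
  have "0 \<cdot>\<^sub>v w = 0\<^sub>v n" using w by (intro eq_vecI) auto
  then show ?thesis by (simp add: poly_act_pCons mult_A_carrier poly_act_carrier)
qed

text \<open>Passing from Horner's scheme to the powers \<open>A^k w\<close> turns
  \<open>p(A) w = 0\<close> into a linear system for the coefficients of \<open>p\<close>.\<close>

lemma poly_act_coeffs:
  assumes "i < n"
  shows "poly_act A (Poly cs) w $ i = (\<Sum>k<length cs. cs ! k * (((*\<^sub>v) A ^^ k) w) $ i)"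
proof -
  have pow: "((*\<^sub>v) A ^^ k) w \<in> carrier_vec n" for k
    by (induction k) (auto simp: w mult_A_carrier)
  \<comment> \<open>The extra power \<open>j\<close> is needed for the induction: removing the
    leading entry of the list raises \<open>j\<close> by one.\<close>
  have "((*\<^sub>v) A ^^ j) (poly_act A (Poly cs) w) $ i = (\<Sum>k<length cs. cs ! k * (((*\<^sub>v) A ^^ (j + k)) w) $ i)" for j
    using assms
  proof (induction cs arbitrary: j)
    case Nil
    have "((*\<^sub>v) A ^^ j) (0\<^sub>v n) = 0\<^sub>v n" by (induction j) (auto simp: mult_A_zero)
    with Nil show ?case by (simp add: poly_act_0)
  next
    case (Cons a cs)
    have lin: "((*\<^sub>v) A ^^ j) (a \<cdot>\<^sub>v w + v) = a \<cdot>\<^sub>v ((*\<^sub>v) A ^^ j) w + ((*\<^sub>v) A ^^ j) v \<and> ((*\<^sub>v) A ^^ j) v \<in> carrier_vec n"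
      if "v \<in> carrier_vec n" for v
      by (induction j) (use that pow w in \<open>auto simp: mult_add_distrib_mat_vec[OF A] mult_mat_vec[OF A] mult_A_carrier\<close>)
    show ?case
      using lin[of "A *\<^sub>v poly_act A (Poly cs) w"] Cons.IH[of "Suc j"] Cons.prems pow[of j]
      by (auto simp add: carrier_vecD poly_act_carrier mult_A_carrier poly_act_pCons sum.lessThan_Suc_shift funpow_swap1 simp del: sum.lessThan_Suc)
  qed
  from this[of 0] show ?thesis by simp
qed

text \<open>The \<open>n + 1\<close> vectors \<open>w, A w, ..., A^n w\<close> lie in dimension
  \<open>n\<close> and so satisfy a nontrivial linear relation.\<close>

lemma exists_annihilating_poly: "\<exists>p. p \<noteq> 0 \<and> poly_act A p w = 0\<^sub>v n"
proof -
  \<comment> \<open>The vector \<open>f i\<close> collects the \<open>i\<close>-th entries of all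
    the \<open>A^k w\<close>; a vector orthogonal to each \<open>f i\<close> lists the coefficients
    of a relation.\<close>
  define f where "f i = vec (Suc n) (\<lambda>k. (((*\<^sub>v) A ^^ k) w) $ i)" for i
  obtain c where c: "c \<in> carrier_vec (Suc n)" "c \<noteq> 0\<^sub>v (Suc n)" "\<And>i. i < n \<Longrightarrow> f i \<bullet> c = 0"
    by (rule exists_nonzero_orthogonal[of n "Suc n" f]) (auto simp: f_def)
  define p where "p = Poly (list_of_vec c)"
  obtain k where k: "k < Suc n" "c $ k \<noteq> 0"
    using c(1,2) by (metis carrier_vecD eq_vecI index_zero_vec)
  have "coeff p k = c $ k"
    using c(1) k by (simp add: p_def nth_default_def list_of_vec_index)
  with k have "p \<noteq> 0" by auto
  moreover have "poly_act A p w = 0\<^sub>v n"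
  proof (rule eq_vecI)
    fix i assume i: "i < dim_vec (0\<^sub>v n :: 'a vec)"
    then have "poly_act A p w $ i = f i \<bullet> c"
      using c(1) by (auto simp: p_def poly_act_coeffs scalar_prod_def f_def list_of_vec_index mult.commute
          atLeast0LessThan intro!: sum.cong)
    then show "poly_act A p w $ i = 0\<^sub>v n $ i"
      using i c(3) by simp
  qed (use carrier_vecD[OF poly_act_carrier] in simp)
  ultimately show ?thesis by blast
qed

end

text \<open>The quadratic is \<open>(t - z)(t - cnj z)\<close>. The remainder of \<open>p\<close>
  modulo it is real, of degree at most 1, and vanishes at the nonreal \<open>z\<close>, hence is
  zero.\<close>

lemma nonreal_root_quadratic_dvd:
  fixes p :: "real poly" and z :: complex
  assumes root: "poly (map_poly of_real p) z = 0" and im: "Im z \<noteq> 0"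
  shows "[: (Re z)\<^sup>2 + (Im z)\<^sup>2, - 2 * Re z, 1 :] dvd p"
proof -
  interpret of_real_poly_hom: map_poly_comm_ring_hom "of_real :: real \<Rightarrow> complex" ..
  let ?g = "[: (Re z)\<^sup>2 + (Im z)\<^sup>2, - 2 * Re z, 1 :] :: real poly"
  define h where "h = p mod ?g"
  have gz: "poly (map_poly of_real ?g) z = 0"
    by (simp add: map_poly_pCons complex_eq_iff power2_eq_square algebra_simps)
  have "degree h < 2 \<or> h = 0"
    using degree_mod_less[of ?g p] by (auto simp: h_def)
  then have deg: "degree h \<le> 1" by auto
  then have h: "h = [: coeff h 0, coeff h 1 :]"
    by (intro poly_eqI) (auto simp: coeff_pCons coeff_eq_0 split: nat.splits)
  have "p = ?g * (p div ?g) + h" unfolding h_def by (rule mult_div_mod_eq[symmetric])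
  then have "poly (map_poly of_real p) z =
      poly (map_poly of_real ?g) z * poly (map_poly of_real (p div ?g)) z + poly (map_poly of_real h) z"
    by (metis of_real_poly_hom.hom_add of_real_poly_hom.hom_mult poly_add poly_mult)
  with root gz have "poly (map_poly of_real h) z = 0" by simp
  moreover have linear: "poly (map_poly of_real [:c, d:]) z = of_real c + z * of_real d" for c d :: real
    by (simp add: of_real_hom.map_poly_pCons_hom)
  ultimately have "of_real (coeff h 0) + z * of_real (coeff h 1) = (0 :: complex)"
    using linear[of "coeff h 0" "coeff h 1", folded h] by simp
  \<comment> \<open>The imaginary part reads \<open>Im z * coeff h 1 = 0\<close>; the real part then
    gives the constant coefficient.\<close>
  then have "coeff h 1 = 0" "coeff h 0 = 0"
    using im by (auto simp: complex_eq_iff)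
  with h have "h = 0" by simp
  then show ?thesis by (simp add: h_def dvd_eq_mod_eq_0)
qed

text \<open>The eigenvector is delivered as \<open>p(A) w\<close> so that
  \<open>poly_act_closed\<close> can place it in an invariant subspace. It comes from splitting off
  a real linear factor of a least-degree annihilator of \<open>w\<close>; positivity of the form
  given by \<open>M\<close> rules out a nonreal root.\<close>

lemma selfadjoint_poly_act_eigenvector:
  fixes A M :: "real mat"
  assumes A: "A \<in> carrier_mat n n" and M: "M \<in> carrier_mat n n" "pos_def n M"
    and selfadj: "\<And>u v. u \<in> carrier_vec n \<Longrightarrow> v \<in> carrier_vec n \<Longrightarrow>
      u \<bullet> (M *\<^sub>v (A *\<^sub>v v)) = (A *\<^sub>v u) \<bullet> (M *\<^sub>v v)"
    and w: "w \<in> carrier_vec n" "w \<noteq> 0\<^sub>v n"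
  obtains p a where "poly_act A p w \<noteq> 0\<^sub>v n" "A *\<^sub>v poly_act A p w = a \<cdot>\<^sub>v poly_act A p w"
proof -
  define ann where "ann p \<longleftrightarrow> p \<noteq> 0 \<and> poly_act A p w = 0\<^sub>v n" for p
  obtain p0 where "ann p0"
    using exists_annihilating_poly[OF A w(1)] by (auto simp: ann_def)
  then obtain p where p: "ann p" and min: "\<And>q. ann q \<Longrightarrow> degree p \<le> degree q"
    using ex_has_least_nat[of ann p0 degree] by blast
  have p0: "p \<noteq> 0" and pw: "poly_act A p w = 0\<^sub>v n"
    using p by (auto simp: ann_def)
  note act_simps = poly_act_add[OF A w(1)] poly_act_smult[OF A w(1)] poly_act_pCons_0[OF A w(1)]
    poly_act_0[OF A w(1)]
  have nonconst: "degree p \<noteq> 0"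
  proof
    assume "degree p = 0"
    then obtain c where c: "p = [:c:]" by (rule degree_eq_zeroE)
    with p0 have "c \<noteq> 0" by simp
    have "c \<cdot>\<^sub>v w = 0\<^sub>v n"
      using pw w A c poly_act_0[OF A w(1)] mult_A_zero[OF A] by (simp add: poly_act_pCons[OF A w(1)])
    then have "w = 0\<^sub>v n"
      using \<open>c \<noteq> 0\<close> w(1) by (auto simp: vec_eq_iff)
    with w show False by simp
  qed
  have "\<not> constant (poly (map_poly complex_of_real p))"
    using nonconst by (simp add: constant_degree)
  then obtain z where z: "poly (map_poly complex_of_real p) z = 0"
    using fundamental_theorem_of_algebra by blast
  \<comment> \<open>The cofactor of a nonconstant factor has smaller degree than \<open>p\<close>,
    so by minimality it cannot annihilate \<open>w\<close>.\<close>
  have quotient: "q \<noteq> 0 \<and> poly_act A q w \<noteq> 0\<^sub>v n" if "p = g * q" "degree g \<noteq> 0" for g q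
  proof -
    have "q \<noteq> 0" "g \<noteq> 0" using that p0 by auto
    then have "degree q < degree p" using that by (simp add: degree_mult_eq)
    with min[of q] \<open>q \<noteq> 0\<close> show ?thesis by (auto simp: ann_def)
  qed
  show ?thesis
  proof (cases "Im z = 0")
    case True
    then have "z = of_real (Re z)" by (simp add: complex_eq_iff)
    with z have "of_real (poly p (Re z)) = (0 :: complex)"
      by (metis of_real_hom.poly_map_poly)
    then have "poly p (Re z) = 0" by simp
    then obtain q where q: "p = [: - Re z, 1 :] * q"
      by (auto simp: poly_eq_0_iff_dvd)
    define v where "v = poly_act A q w"
    have v: "v \<in> carrier_vec n" by (simp add: v_def poly_act_carrier[OF A w(1)])
    have "p = smult (- Re z) q + pCons 0 q" by (simp add: q)
    then have "0\<^sub>v n = - Re z \<cdot>\<^sub>v v + A *\<^sub>v v"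
      using pw by (simp only: act_simps v_def)
    then have *: "(- Re z \<cdot>\<^sub>v v + A *\<^sub>v v) $ i = 0" if "i < n" for i
      using that by (metis index_zero_vec(1))
    have "A *\<^sub>v v = Re z \<cdot>\<^sub>v v"
    proof (rule eq_vecI)
      fix i assume "i < dim_vec (Re z \<cdot>\<^sub>v v)"
      with v *[of i] A show "(A *\<^sub>v v) $ i = (Re z \<cdot>\<^sub>v v) $ i" by simp
    qed (use A v in auto)
    then show ?thesis
      using that[of q "Re z"] quotient[OF q] by (simp add: v_def)
  next
    case False
    define a b where "a = Re z" and "b = Im z"
    have b: "b \<noteq> 0" using False by (simp add: b_def)
    obtain q where q: "p = [: a\<^sup>2 + b\<^sup>2, - 2 * a, 1 :] * q"
      using nonreal_root_quadratic_dvd[OF z False] by (auto simp: a_def b_def dvd_def)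
    define v where "v = poly_act A q w"
    have v: "v \<in> carrier_vec n" by (simp add: v_def poly_act_carrier[OF A w(1)])
    have v0: "v \<noteq> 0\<^sub>v n"
      using quotient[OF q] by (simp add: v_def)
    define v1 v2 where "v1 = A *\<^sub>v v" and "v2 = A *\<^sub>v v1"
    define f where "f x y = x \<bullet> (M *\<^sub>v y)" for x y
    have v12: "v1 \<in> carrier_vec n" "v2 \<in> carrier_vec n"
      using v A by (auto simp: v1_def v2_def)
    have "0\<^sub>v n = (a\<^sup>2 + b\<^sup>2) \<cdot>\<^sub>v v + ((- 2 * a) \<cdot>\<^sub>v v1 + v2)"
    proof -
      have "p = smult (a\<^sup>2 + b\<^sup>2) q + pCons 0 (smult (- 2 * a) q + pCons 0 q)" by (simp add: q)
      then have "0\<^sub>v n = (a\<^sup>2 + b\<^sup>2) \<cdot>\<^sub>v v + A *\<^sub>v ((- 2 * a) \<cdot>\<^sub>v v + v1)"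
        using pw by (simp only: act_simps v_def v1_def)
      also have "A *\<^sub>v ((- 2 * a) \<cdot>\<^sub>v v + v1) = (- 2 * a) \<cdot>\<^sub>v v1 + v2"
        using v v12 by (simp add: mult_add_distrib_mat_vec[OF A] mult_mat_vec[OF A] v2_def flip: v1_def)
      finally show ?thesis .
    qed
    \<comment> \<open>Pairing the relation \<open>((A - a)^2 + b^2) v = 0\<close> with
      \<open>v\<close> in the form \<open>f\<close> makes it scalar; self-adjointness turns
      \<open>f v v2\<close> into \<open>f v1 v1\<close>.\<close>
    then have "f v (0\<^sub>v n) = f v ((a\<^sup>2 + b\<^sup>2) \<cdot>\<^sub>v v + ((- 2 * a) \<cdot>\<^sub>v v1 + v2))" by simp
    moreover have fadd: "f x (y + y') = f x y + f x y'" "f (y + y') x = f y x + f y' x"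
      if "x \<in> carrier_vec n" "y \<in> carrier_vec n" "y' \<in> carrier_vec n" for x y y'
      using that M(1) by (auto simp: f_def mult_add_distrib_mat_vec[OF M(1)]
          scalar_prod_add_distrib[of _ n] add_scalar_prod_distrib[of _ n])
    moreover have fsm: "f x (c \<cdot>\<^sub>v y) = c * f x y" "f (c \<cdot>\<^sub>v x) y = c * f x y"
      if "x \<in> carrier_vec n" "y \<in> carrier_vec n" for x y c
      using that M(1) by (auto simp: f_def mult_mat_vec[OF M(1)])
    moreover have "f v v2 = f v1 v1" "f v v1 = f v1 v"
      unfolding f_def v2_def v1_def using selfadj v A by auto
    moreover have "f v (0\<^sub>v n) = 0"
      using v M(1) mult_A_zero[OF M(1)] by (simp add: f_def)
    ultimately have zero: "(a\<^sup>2 + b\<^sup>2) * f v v - 2 * a * f v1 v + f v1 v1 = 0"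
      using v v12 by simp
    \<comment> \<open>Completing the square yields
      \<open>f((A - a) v, (A - a) v) + b^2 f(v, v) = 0\<close>, where the first term is nonnegative
      and the second is positive: a contradiction.\<close>
    have "f (v1 + (- a) \<cdot>\<^sub>v v) (v1 + (- a) \<cdot>\<^sub>v v) = f v1 v1 - 2 * a * f v1 v + a\<^sup>2 * f v v"
      using v v12 \<open>f v v1 = f v1 v\<close> by (simp add: fadd fsm power2_eq_square algebra_simps)
    moreover have "f x x \<ge> 0" if "x \<in> carrier_vec n" for x
      using M that mult_A_zero[OF M(1)] by (cases "x = 0\<^sub>v n") (auto simp: f_def pos_def_def intro: less_imp_le)
    then have "f (v1 + (- a) \<cdot>\<^sub>v v) (v1 + (- a) \<cdot>\<^sub>v v) \<ge> 0" using v v12 by simp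
    moreover have "b\<^sup>2 * f v v > 0"
      using b v v0 M(2) by (simp add: f_def pos_def_def)
    ultimately show ?thesis using zero by (simp add: algebra_simps)
  qed
qed

text \<open>Induction on the number of vectors: the \<open>M\<close>-orthogonal complement of the
  eigenvectors found so far is nonzero and invariant under \<open>A\<close>, so it contains a
  further eigenvector, which is then normalized.\<close>

lemma selfadjoint_orthonormal_family:
  fixes A M :: "real mat"
  assumes A: "A \<in> carrier_mat n n" and M: "M \<in> carrier_mat n n" "M\<^sup>T = M" "pos_def n M"
    and selfadj: "\<And>u v. u \<in> carrier_vec n \<Longrightarrow> v \<in> carrier_vec n \<Longrightarrow>
      u \<bullet> (M *\<^sub>v (A *\<^sub>v v)) = (A *\<^sub>v u) \<bullet> (M *\<^sub>v v)"
    and "k \<le> n"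
  shows "\<exists>(u :: nat \<Rightarrow> real vec) \<mu>. \<forall>i<k. u i \<in> carrier_vec n \<and> A *\<^sub>v u i = \<mu> i \<cdot>\<^sub>v u i \<and>
    (\<forall>j<k. (M *\<^sub>v u i) \<bullet> u j = (if i = j then 1 else 0))"
  using \<open>k \<le> n\<close>
proof (induction k)
  case (Suc k)
  then obtain u :: "nat \<Rightarrow> real vec" and \<mu> where
    u: "\<And>i. i < k \<Longrightarrow> u i \<in> carrier_vec n" and Au: "\<And>i. i < k \<Longrightarrow> A *\<^sub>v u i = \<mu> i \<cdot>\<^sub>v u i"
    and orth: "\<And>i j. i < k \<Longrightarrow> j < k \<Longrightarrow> (M *\<^sub>v u i) \<bullet> u j = (if i = j then 1 else 0)"
    by fastforce
  have Mu: "M *\<^sub>v u i \<in> carrier_vec n" if "i < k" for i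
    using u that M by auto
  have M_sym: "(M *\<^sub>v x) \<bullet> y = x \<bullet> (M *\<^sub>v y)" if "x \<in> carrier_vec n" "y \<in> carrier_vec n" for x y
    using transpose_vec_mult_scalar[OF M(1) that(2,1)] M(2) by simp
  have M_sym': "(M *\<^sub>v x) \<bullet> y = (M *\<^sub>v y) \<bullet> x" if "x \<in> carrier_vec n" "y \<in> carrier_vec n" for x y
    using M_sym[OF that] comm_scalar_prod[OF that(1), of "M *\<^sub>v y"] M(1) that by simp
  obtain w where w: "w \<in> carrier_vec n" "w \<noteq> 0\<^sub>v n" "\<And>i. i < k \<Longrightarrow> (M *\<^sub>v u i) \<bullet> w = 0"
    using exists_nonzero_orthogonal[of k n "\<lambda>i. M *\<^sub>v u i"] Suc.prems Mu by auto
  define W where "W = {w \<in> carrier_vec n. \<forall>i<k. (M *\<^sub>v u i) \<bullet> w = 0}"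
  obtain p a where p: "poly_act A p w \<noteq> 0\<^sub>v n" "A *\<^sub>v poly_act A p w = a \<cdot>\<^sub>v poly_act A p w"
    by (rule selfadjoint_poly_act_eigenvector[OF A M(1,3) selfadj w(1,2)])
  define v where "v = poly_act A p w"
  have "v \<in> W"
    unfolding v_def
  proof (rule poly_act_closed[OF A w(1)])
    fix x assume x: "x \<in> W"
    \<comment> \<open>Invariance of \<open>W\<close>: self-adjointness moves \<open>A\<close> onto
      the eigenvector \<open>u i\<close>, which only contributes the factor
      \<open>\<mu> i\<close>.\<close>
    have "(M *\<^sub>v u i) \<bullet> (A *\<^sub>v x) = 0" if "i < k" for i
    proof -
      have "(M *\<^sub>v u i) \<bullet> (A *\<^sub>v x) = (A *\<^sub>v u i) \<bullet> (M *\<^sub>v x)"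
        using x u[OF that] A by (simp add: M_sym selfadj W_def)
      also have "\<dots> = \<mu> i * ((M *\<^sub>v u i) \<bullet> x)"
        using x u[OF that] M(1) Au[OF that] by (simp add: M_sym W_def)
      finally show ?thesis using x that by (simp add: W_def)
    qed
    then show "A *\<^sub>v x \<in> W" using x A by (auto simp: W_def)
  qed (use w Mu in \<open>auto simp: W_def scalar_prod_add_distrib[of _ n] scalar_prod_smult_distrib[of _ n]\<close>)
  then have v: "v \<in> carrier_vec n" and v_orth: "\<And>i. i < k \<Longrightarrow> (M *\<^sub>v u i) \<bullet> v = 0"
    by (auto simp: W_def)
  define s where "s = (M *\<^sub>v v) \<bullet> v"
  have s: "s > 0"
    using M(3) p(1) v by (auto simp: s_def M_sym pos_def_def v_def[symmetric])
  define v' where "v' = (1 / sqrt s) \<cdot>\<^sub>v v"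
  have v': "v' \<in> carrier_vec n" using v by (simp add: v'_def)
  have Av': "A *\<^sub>v v' = a \<cdot>\<^sub>v v'"
    using p(2) v by (simp add: v'_def mult_mat_vec[OF A] smult_smult_assoc mult.commute flip: v_def)
  have norm: "(M *\<^sub>v v') \<bullet> v' = 1"
    using s v M(1) by (simp add: v'_def mult_mat_vec[OF M(1)] flip: s_def)
  have orth': "(M *\<^sub>v u i) \<bullet> v' = 0" "(M *\<^sub>v v') \<bullet> u i = 0" if "i < k" for i
    using v_orth[OF that] M_sym'[OF v' u[OF that]] Mu[OF that] v by (auto simp: v'_def)
  show ?case
    by (rule exI[of _ "u(k := v')"], rule exI[of _ "\<mu>(k := a)"])
      (use u v' Au Av' orth orth' norm in \<open>auto simp: less_Suc_eq\<close>)
qed simp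

section \<open>Coordinates with respect to dual bases\<close>

lemma vec_first_append: "a \<in> carrier_vec n \<Longrightarrow> vec_first (a @\<^sub>v b) n = a"
  by (intro eq_vecI) (auto simp: vec_first_def)

lemma vec_last_append: "a \<in> carrier_vec n \<Longrightarrow> b \<in> carrier_vec m \<Longrightarrow> vec_last (a @\<^sub>v b) m = b"
  by (intro eq_vecI) (auto simp: vec_last_def)

lemma vec_first_add:
  "v \<in> carrier_vec (n + m) \<Longrightarrow> w \<in> carrier_vec (n + m) \<Longrightarrow> vec_first (v + w) n = vec_first v n + vec_first w n"
  by (intro eq_vecI) (auto simp: vec_first_def)

lemma vec_last_add:
  "v \<in> carrier_vec (n + m) \<Longrightarrow> w \<in> carrier_vec (n + m) \<Longrightarrow> vec_last (v + w) m = vec_last v m + vec_last w m"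
  by (intro eq_vecI) (auto simp: vec_last_def)

lemma vec_first_smult: "v \<in> carrier_vec (n + m) \<Longrightarrow> vec_first (c \<cdot>\<^sub>v v) n = c \<cdot>\<^sub>v vec_first v n"
  by (intro eq_vecI) (auto simp: vec_first_def)

lemma vec_last_smult: "v \<in> carrier_vec (n + m) \<Longrightarrow> vec_last (c \<cdot>\<^sub>v v) m = c \<cdot>\<^sub>v vec_last v m"
  by (intro eq_vecI) (auto simp: vec_last_def)

lemma block_H_carrier:
  "K \<in> carrier_mat n n \<Longrightarrow> M \<in> carrier_mat n n \<Longrightarrow> block_H n K M \<in> carrier_mat (n + n) (n + n)"
  by (simp add: block_H_def)

lemma block_H_mult_append:
  assumes "K \<in> carrier_mat n n" "M \<in> carrier_mat n n" "y \<in> carrier_vec n" "x \<in> carrier_vec n"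
  shows "block_H n K M *\<^sub>v (y @\<^sub>v x) = (K *\<^sub>v x) @\<^sub>v (M *\<^sub>v y)"
proof -
  have "0\<^sub>m n n *\<^sub>v v = 0\<^sub>v n" if "v \<in> carrier_vec n" for v :: "real vec"
    using that by (intro eq_vecI) auto
  moreover have "K *\<^sub>v x \<in> carrier_vec n" "M *\<^sub>v y \<in> carrier_vec n"
    using assms by auto
  ultimately show ?thesis
    using assms by (simp add: block_H_def four_block_mat_mult_vec[of _ n n _ n _ n])
qed

text \<open>Only the pairing is assumed. That both families are bases follows, since their matrices
  are square.\<close>

locale dual_bases =
  fixes n :: nat and p q :: "nat \<Rightarrow> real vec"
  assumes p_carrier: "j < n \<Longrightarrow> p j \<in> carrier_vec n"
    and q_carrier: "j < n \<Longrightarrow> q j \<in> carrier_vec n"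
    and dual: "i < n \<Longrightarrow> j < n \<Longrightarrow> q i \<bullet> p j = (if i = j then 1 else 0)"
begin

section \<open>The matrices of the two bases and the expansion of vectors\<close>

definition P :: "real mat" where "P = mat_of_cols n (map p [0..<n])"
definition Q :: "real mat" where "Q = mat_of_cols n (map q [0..<n])"

lemma P_carrier: "P \<in> carrier_mat n n" and Q_carrier: "Q \<in> carrier_mat n n"
  using mat_of_cols_carrier(1)[of n "map p [0..<n]"] mat_of_cols_carrier(1)[of n "map q [0..<n]"]
  by (simp_all add: P_def Q_def)

lemma col_P: "j < n \<Longrightarrow> col P j = p j" and col_Q: "j < n \<Longrightarrow> col Q j = q j"
  using p_carrier q_carrier by (simp_all add: P_def Q_def)

lemma transpose_Q_mult_P: "Q\<^sup>T * P = 1\<^sub>m n"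
  using P_carrier Q_carrier by (intro eq_matI) (auto simp: col_P col_Q dual)

text \<open>A left inverse of a square matrix is also a right inverse. This is the completeness
  relation from which all expansions follow.\<close>

lemma P_mult_transpose_Q: "P * Q\<^sup>T = 1\<^sub>m n"
  by (rule mat_mult_left_right_inverse[OF _ P_carrier transpose_Q_mult_P]) (simp add: Q_carrier)

lemma transpose_Q_mult_vec: "v \<in> carrier_vec n \<Longrightarrow> Q\<^sup>T *\<^sub>v v = vec n (\<lambda>j. q j \<bullet> v)"
  using Q_carrier by (intro eq_vecI) (auto simp: col_Q)

lemma transpose_P_mult_vec: "v \<in> carrier_vec n \<Longrightarrow> P\<^sup>T *\<^sub>v v = vec n (\<lambda>j. p j \<bullet> v)"
  using P_carrier by (intro eq_vecI) (auto simp: col_P)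

lemma P_transpose_Q_mult_vec: "v \<in> carrier_vec n \<Longrightarrow> P *\<^sub>v (Q\<^sup>T *\<^sub>v v) = v"
  using P_carrier Q_carrier by (subst assoc_mult_mat_vec[symmetric]) (auto simp: P_mult_transpose_Q)

lemma scalar_prod_expand:
  assumes v: "v \<in> carrier_vec n" and w: "w \<in> carrier_vec n"
  shows "v \<bullet> w = (\<Sum>j<n. (q j \<bullet> v) * (p j \<bullet> w))"
proof -
  have "v \<bullet> w = (P *\<^sub>v (Q\<^sup>T *\<^sub>v v)) \<bullet> w"
    using v by (simp add: P_transpose_Q_mult_vec)
  also have "\<dots> = (Q\<^sup>T *\<^sub>v v) \<bullet> (P\<^sup>T *\<^sub>v w)"
    using transpose_vec_mult_scalar[of "P\<^sup>T" n n w "Q\<^sup>T *\<^sub>v v"] v w P_carrier Q_carrier by auto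
  finally show ?thesis
    using v w by (simp add: transpose_Q_mult_vec transpose_P_mult_vec scalar_prod_def lessThan_atLeast0)
qed

lemma eq_by_q:
  assumes "v \<in> carrier_vec n" "w \<in> carrier_vec n" "\<And>j. j < n \<Longrightarrow> q j \<bullet> v = q j \<bullet> w"
  shows "v = w"
proof -
  have "Q\<^sup>T *\<^sub>v v = Q\<^sup>T *\<^sub>v w"
    using assms by (auto simp: transpose_Q_mult_vec)
  then show ?thesis
    using assms P_transpose_Q_mult_vec by metis
qed

text \<open>The roles of \<open>p\<close> and \<open>q\<close> are symmetric, so each fact about one
  family transfers to the other.\<close>

lemma swap: "dual_bases n q p"
  by unfold_locales
    (use p_carrier q_carrier dual comm_scalar_prod[OF p_carrier q_carrier] in \<open>auto split: if_splits\<close>)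

section \<open>Coordinates on the doubled space\<close>

definition J :: "(bool \<times> nat) set" where "J = UNIV \<times> {..<n}"

text \<open>The Boolean selects the block: \<open>True\<close> for \<open>p\<close> in the first
  block, \<open>False\<close> for \<open>q\<close> in the second.\<close>

definition e :: "bool \<times> nat \<Rightarrow> real vec" where
  "e x = (if fst x then p (snd x) @\<^sub>v 0\<^sub>v n else 0\<^sub>v n @\<^sub>v q (snd x))"

text \<open>These are the functionals dual to \<open>e\<close>: the coefficient of a
  \<open>p\<close> vector is read off by pairing with \<open>q\<close>, and conversely.\<close>

definition coord :: "bool \<times> nat \<Rightarrow> real vec \<Rightarrow> real" where
  "coord x v = (if fst x then q (snd x) \<bullet> vec_first v n else p (snd x) \<bullet> vec_last v n)"

definition coord_space :: "(bool \<times> nat) set \<Rightarrow> real vec set" where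
  "coord_space S = {v \<in> carrier_vec (n + n). \<forall>x \<in> J - S. coord x v = 0}"

lemma J_iff: "x \<in> J \<longleftrightarrow> snd x < n"
  by (cases x) (auto simp: J_def)

lemma finite_J: "finite J"
  by (simp add: J_def)

lemma e_carrier: "x \<in> J \<Longrightarrow> e x \<in> carrier_vec (n + n)"
  using p_carrier q_carrier by (auto simp: e_def J_iff)

lemma e_image_carrier: "S \<subseteq> J \<Longrightarrow> e ` S \<subseteq> carrier_vec (n + n)"
  using e_carrier by blast

lemma coord_e: "x \<in> J \<Longrightarrow> y \<in> J \<Longrightarrow> coord x (e y) = (if x = y then 1 else 0)"
  using p_carrier q_carrier dual dual_bases.dual[OF swap]
  by (cases x; cases y) (auto simp: coord_def e_def J_iff vec_first_append vec_last_append[of _ n])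

lemma coord_add:
  assumes "x \<in> J" "v \<in> carrier_vec (n + n)" "w \<in> carrier_vec (n + n)"
  shows "coord x (v + w) = coord x v + coord x w"
  using assms p_carrier[of "snd x"] q_carrier[of "snd x"]
  by (auto simp: coord_def J_iff vec_first_add vec_last_add scalar_prod_add_distrib[of _ n])

lemma coord_smult:
  assumes "x \<in> J" "v \<in> carrier_vec (n + n)"
  shows "coord x (c \<cdot>\<^sub>v v) = c * coord x v"
  using assms p_carrier[of "snd x"] q_carrier[of "snd x"]
  by (auto simp: coord_def J_iff vec_first_smult vec_last_smult scalar_prod_smult_distrib[of _ n])

lemma coord_zero: "x \<in> J \<Longrightarrow> coord x (0\<^sub>v (n + n)) = 0"
  using coord_smult[of x "0\<^sub>v (n + n)" 0] by (simp add: zero_vec_def smult_vec_def)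

lemma coord_finsum:
  assumes "finite A" "f \<in> A \<rightarrow> carrier_vec (n + n)" "x \<in> J"
  shows "coord x (finsum_vec TYPE(real) (n + n) f A) = (\<Sum>a\<in>A. coord x (f a))"
  using assms
proof (induction A)
  case empty
  then show ?case by (simp add: finsum_vec_empty coord_zero)
next
  case (insert a A)
  then have "f \<in> A \<rightarrow> carrier_vec (n + n)" "f a \<in> carrier_vec (n + n)" by auto
  with insert show ?case
    by (simp add: finsum_vec_insert finsum_vec_closed coord_add)
qed

lemma coord_eqI:
  assumes v: "v \<in> carrier_vec (n + n)" and w: "w \<in> carrier_vec (n + n)"
    and eq: "\<And>x. x \<in> J \<Longrightarrow> coord x v = coord x w"
  shows "v = w"
proof -
  have "vec_first v n = vec_first w n"
    by (rule eq_by_q) (use eq[of "(True, _)"] in \<open>auto simp: coord_def J_iff\<close>)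
  moreover have "vec_last v n = vec_last w n"
    by (rule dual_bases.eq_by_q[OF swap]) (use eq[of "(False, _)"] in \<open>auto simp: coord_def J_iff\<close>)
  ultimately show ?thesis
    using vec_first_last_append[OF v] vec_first_last_append[OF w] by metis
qed

lemma coord_combination:
  assumes "S \<subseteq> J" "x \<in> J"
  shows "coord x (finsum_vec TYPE(real) (n + n) (\<lambda>y. a y \<cdot>\<^sub>v e y) S) = (if x \<in> S then a x else 0)"
proof -
  have fin: "finite S" using assms finite_J finite_subset by blast
  have "coord x (finsum_vec TYPE(real) (n + n) (\<lambda>y. a y \<cdot>\<^sub>v e y) S) = (\<Sum>y\<in>S. coord x (a y \<cdot>\<^sub>v e y))"
    by (rule coord_finsum) (use fin assms e_carrier in auto)
  also have "\<dots> = (\<Sum>y\<in>S. if x = y then a y else 0)"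
    using assms e_carrier by (intro sum.cong) (auto simp: coord_smult coord_e)
  finally show ?thesis using fin by simp
qed

section \<open>Spans, independence and direct sums in coordinates\<close>

sublocale vs: vec_space "TYPE(real)" "n + n" .

lemma submodule_coord_space: "LinearCombinations.submodule class_ring (coord_space S) vs.V"
  by (rule submodule.intro)
    (auto simp: vs.module_axioms coord_space_def coord_add coord_smult coord_zero module_vec_simps class_ring_simps)

lemma span_e:
  assumes S: "S \<subseteq> J"
  shows "span_vec (n + n) (e ` S) = coord_space S"
proof
  have "e ` S \<subseteq> coord_space S"
  proof -
    have "e y \<in> coord_space S" if "y \<in> S" for y
      using S that e_carrier[of y] by (auto simp: coord_space_def coord_e[OF _ subsetD[OF S that]])
    then show ?thesis by blast
  qed
  then show "span_vec (n + n) (e ` S) \<subseteq> coord_space S"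
    by (rule vs.span_is_subset) (rule submodule_coord_space)
  show "coord_space S \<subseteq> span_vec (n + n) (e ` S)"
  proof
    fix v assume v: "v \<in> coord_space S"
    note carrier = e_image_carrier[OF S]
    have mem: "finsum_vec TYPE(real) (n + n) (\<lambda>y. coord y v \<cdot>\<^sub>v e y) T \<in> span_vec (n + n) (e ` S)"
      if "finite T" "T \<subseteq> S" for T
      using that
    proof (induction T)
      case empty
      then show ?case using vs.span_zero by (simp add: finsum_vec_empty del: vs.finsum_vec)
    next
      case (insert x T)
      then have "(\<lambda>y. coord y v \<cdot>\<^sub>v e y) \<in> insert x T \<rightarrow> carrier_vec (n + n)"
        using e_image_carrier[OF S] by auto
      moreover from this have "coord x v \<cdot>\<^sub>v e x \<in> carrier_vec (n + n)" by auto
      moreover have "coord x v \<cdot>\<^sub>v e x \<in> span_vec (n + n) (e ` S)"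
        using insert.prems carrier by (intro vs.smult_in_span vs.span_mem) auto
      ultimately show ?case
        using insert vs.span_add1[OF carrier]
        by (simp add: finsum_vec_insert del: vs.finsum_vec index_smult_vec)
    qed
    have "v = finsum_vec TYPE(real) (n + n) (\<lambda>y. coord y v \<cdot>\<^sub>v e y) S"
    proof (rule coord_eqI)
      show "finsum_vec TYPE(real) (n + n) (\<lambda>y. coord y v \<cdot>\<^sub>v e y) S \<in> carrier_vec (n + n)"
        by (rule finsum_vec_closed) (use S e_carrier in auto)
    qed (use v in \<open>auto simp: coord_combination[OF S] coord_space_def simp del: vs.finsum_vec\<close>)
    with mem[of S] show "v \<in> span_vec (n + n) (e ` S)"
      using S finite_J finite_subset by (metis order_refl)
  qed
qed

lemma inj_on_e: "inj_on e J"
  using coord_e by (intro inj_onI) (metis zero_neq_one)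

text \<open>Applying \<open>coord x\<close> to a vanishing combination isolates the coefficient of
  \<open>e x\<close>.\<close>

lemma lin_indpt_e:
  assumes S: "S \<subseteq> J"
  shows "vs.lin_indpt (e ` S)"
proof (rule vs.finite_lin_indpt2)
  show fin: "finite (e ` S)" using S finite_J finite_subset by blast
  show carrier: "e ` S \<subseteq> carrier_vec (n + n)" using S by (rule e_image_carrier)
  fix a assume "vs.lincomb a (e ` S) = 0\<^sub>v (n + n)"
  then have zero: "finsum_vec TYPE(real) (n + n) (\<lambda>v. a v \<cdot>\<^sub>v v) (e ` S) = 0\<^sub>v (n + n)"
    by (simp add: vs.lincomb_def)
  have "a (e x) = 0" if x: "x \<in> S" for x
  proof -
    have "0 = (\<Sum>v\<in>e ` S. coord x (a v \<cdot>\<^sub>v v))"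
      using coord_finsum[OF fin, of "\<lambda>v. a v \<cdot>\<^sub>v v" x] x S carrier zero coord_zero[of x] by auto
    also have "\<dots> = (\<Sum>y\<in>S. coord x (a (e y) \<cdot>\<^sub>v e y))"
      using inj_on_subset[OF inj_on_e S] by (simp add: sum.reindex)
    also have "\<dots> = (\<Sum>y\<in>S. if x = y then a (e y) else 0)"
    proof (rule sum.cong)
      fix y assume "y \<in> S"
      with S x have "x \<in> J" "y \<in> J" by auto
      then show "coord x (a (e y) \<cdot>\<^sub>v e y) = (if x = y then a (e y) else 0)"
        by (simp add: coord_smult e_carrier coord_e)
    qed simp
    also have "\<dots> = a (e x)"
      using x S finite_J finite_subset[of S J] by simp
    finally show ?thesis by simp
  qed
  then show "\<forall>v\<in>e ` S. a v = 0" by auto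
qed

lemma subspace_coord_space: "S \<subseteq> J \<Longrightarrow> subspace_vec (n + n) (coord_space S)"
  using vs.span_is_subspace[OF e_image_carrier] span_e by metis

text \<open>Each basis index belongs to exactly one \<open>S i\<close>, so each coordinate of a sum
  comes from a single component.\<close>

lemma is_direct_sum_coord_space:
  assumes "finite I" and S: "\<And>i. i \<in> I \<Longrightarrow> S i \<subseteq> J"
    and part: "\<And>x. x \<in> J \<Longrightarrow> \<exists>!i. i \<in> I \<and> x \<in> S i"
  shows "is_direct_sum (n + n) I (\<lambda>i. coord_space (S i))"
  unfolding is_direct_sum_def
proof (intro conjI ballI)
  fix v :: "real vec" assume v: "v \<in> carrier_vec (n + n)"
  \<comment> \<open>The \<open>i\<close>-th component keeps the coordinates of \<open>v\<close> in
    \<open>S i\<close>; restricting to \<open>I\<close> puts the family in the extensional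
    product.\<close>
  define w where "w = (\<lambda>i\<in>I. finsum_vec TYPE(real) (n + n) (\<lambda>y. coord y v \<cdot>\<^sub>v e y) (S i))"
  have w_carrier: "w i \<in> carrier_vec (n + n)" if "i \<in> I" for i
    unfolding w_def restrict_apply'[OF that] using S[OF that] e_carrier by (intro finsum_vec_closed) auto
  have coord_w: "coord x (w i) = (if x \<in> S i then coord x v else 0)" if "i \<in> I" "x \<in> J" for i x
    unfolding w_def restrict_apply'[OF that(1)] using coord_combination[OF S[OF that(1)] that(2)] by simp
  \<comment> \<open>This identity serves both existence, for \<open>w\<close> itself, and
    uniqueness, for any other decomposition.\<close>
  have coord_sum: "coord x (finsum_vec TYPE(real) (n + n) w' I) = coord x (w' i)"
    if w': "w' \<in> (\<Pi>\<^sub>E i\<in>I. coord_space (S i))" and x: "x \<in> J" and i: "i \<in> I" "x \<in> S i" for w' i x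
  proof -
    have mem: "w' j \<in> coord_space (S j)" if "j \<in> I" for j using w' that by auto
    have "coord x (finsum_vec TYPE(real) (n + n) w' I) = (\<Sum>j\<in>I. coord x (w' j))"
      using mem x \<open>finite I\<close> by (intro coord_finsum) (auto simp: coord_space_def)
    also have "\<dots> = (\<Sum>j\<in>I. if j = i then coord x (w' i) else 0)"
      using mem part[OF x] i x by (intro sum.cong) (auto simp: coord_space_def)
    finally show ?thesis using i \<open>finite I\<close> by simp
  qed
  show "\<exists>!w. w \<in> (\<Pi>\<^sub>E i\<in>I. coord_space (S i)) \<and> v = finsum_vec TYPE(real) (n + n) w I"
  proof (rule ex1I)
    have w: "w \<in> (\<Pi>\<^sub>E i\<in>I. coord_space (S i))"
      using w_carrier coord_w by (auto simp: coord_space_def w_def)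
    moreover have "v = finsum_vec TYPE(real) (n + n) w I"
    proof (rule coord_eqI[OF v])
      show "finsum_vec TYPE(real) (n + n) w I \<in> carrier_vec (n + n)"
        using w_carrier by (intro finsum_vec_closed) auto
      fix x assume x: "x \<in> J"
      then obtain i where i: "i \<in> I" "x \<in> S i" using part by blast
      show "coord x v = coord x (finsum_vec TYPE(real) (n + n) w I)"
        using coord_sum[OF w x i] coord_w[OF i(1) x] i by simp
    qed
    ultimately show "w \<in> (\<Pi>\<^sub>E i\<in>I. coord_space (S i)) \<and> v = finsum_vec TYPE(real) (n + n) w I" ..
    fix w' assume w': "w' \<in> (\<Pi>\<^sub>E i\<in>I. coord_space (S i)) \<and> v = finsum_vec TYPE(real) (n + n) w' I"
    show "w' = w"
    proof (rule PiE_ext)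
      show "w' \<in> (\<Pi>\<^sub>E i\<in>I. coord_space (S i))" "w \<in> (\<Pi>\<^sub>E i\<in>I. coord_space (S i))"
        using w w' by auto
      fix i assume i: "i \<in> I"
      have mem: "w' i \<in> coord_space (S i)" using w' i by auto
      show "w' i = w i"
      proof (rule coord_eqI)
        fix x assume x: "x \<in> J"
        show "coord x (w' i) = coord x (w i)"
          using coord_sum[OF conjunct1[OF w'] x i] w' coord_w[OF i x] mem x by (auto simp: coord_space_def)
      qed (use mem w_carrier i in \<open>auto simp: coord_space_def\<close>)
    qed
  qed
qed (use S subspace_coord_space in auto)

text \<open>In the expansion of the scalar product by dual bases, the \<open>j\<close>-th term is a
  product of a coordinate of each vector at index \<open>j\<close>. As \<open>j\<close> cannot lie
  in both \<open>C\<close> and \<open>D\<close>, one factor vanishes.\<close>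

lemma biorthogonal_coord_space:
  assumes "C \<inter> D = {}"
  shows "biorthogonal_spaces n (coord_space (UNIV \<times> C)) (coord_space (UNIV \<times> D))"
proof -
  have "vec_first \<xi> n \<bullet> vec_last \<eta> n = 0"
    if mem: "\<xi> \<in> coord_space (UNIV \<times> C)" "\<eta> \<in> coord_space (UNIV \<times> D)" and disj: "C \<inter> D = {}" for \<xi> \<eta> C D
  proof -
    have "coord (True, j) \<xi> * coord (False, j) \<eta> = 0" if "j < n" for j
      using mem disj that by (cases "j \<in> C") (auto simp: coord_space_def J_iff)
    then show ?thesis
      by (subst scalar_prod_expand) (auto simp: coord_def intro!: sum.neutral)
  qed
  moreover have "D \<inter> C = {}" using assms by blast
  ultimately show ?thesis
    using assms unfolding biorthogonal_spaces_def biorthogonal_def by blast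
qed

end

section \<open>The spectrum of the block matrix\<close>

lemma order_prod_sum:
  fixes f :: "'a \<Rightarrow> 'b :: idom poly"
  assumes "finite A" "\<And>i. i \<in> A \<Longrightarrow> f i \<noteq> 0"
  shows "Polynomial.order x (\<Prod>i\<in>A. f i) = (\<Sum>i\<in>A. Polynomial.order x (f i))"
  using assms by (induction A) (auto simp: order_mult)

text \<open>Of the factors \<open>t - sqrt c\<close> and \<open>t + sqrt c\<close>, only the first
  can vanish at a positive number.\<close>

lemma order_square_minus_const:
  fixes c \<mu> :: real
  assumes "c \<ge> 0" "\<mu> > 0"
  shows "Polynomial.order \<mu> [:- c, 0, 1:] = (if c = \<mu>\<^sup>2 then 1 else 0)"
proof -
  have "[:- c, 0, 1:] = [:- sqrt c, 1:] * [:sqrt c, 1:]"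
    using assms by simp
  then have "Polynomial.order \<mu> [:- c, 0, 1:] =
      Polynomial.order \<mu> [:- sqrt c, 1:] + Polynomial.order \<mu> [:sqrt c, 1:]"
    by (simp only: order_mult[of "[:- sqrt c, 1:]"] mult_eq_0_iff pCons_eq_0_iff one_neq_zero simp_thms)
  moreover have "sqrt c \<noteq> - \<mu>" using assms real_sqrt_ge_zero[of c] by linarith
  moreover have "- sqrt c = - \<mu> \<longleftrightarrow> c = \<mu>\<^sup>2"
    using assms by (auto simp: real_sqrt_eq_iff real_sqrt_unique)
  ultimately show ?thesis by (simp only: order_linear') simp
qed

text \<open>All four blocks of the characteristic matrix are diagonal and commute, so its
  determinant is that of the diagonal matrix with entries \<open>t^2 - k j * m j\<close>.\<close>

lemma char_poly_block_H_diag: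
  fixes k m :: "nat \<Rightarrow> real"
  shows "char_poly (block_H n (mat_diag n k) (mat_diag n m)) = (\<Prod>j<n. [:- (k j * m j), 0, 1:])"
proof -
  let ?X = "mat_diag n (\<lambda>_. [:0, 1:]) :: real poly mat"
  let ?D = "mat_diag n (\<lambda>j. [:- (k j * m j), 0, 1:]) :: real poly mat"
  have "char_poly_matrix (block_H n (mat_diag n k) (mat_diag n m)) =
      four_block_mat ?X (mat_diag n (\<lambda>j. [:- k j:])) (mat_diag n (\<lambda>j. [:- m j:])) ?X"
    by (rule eq_matI) (auto simp: char_poly_matrix_def block_H_def mat_diag_def)
  then have "char_poly (block_H n (mat_diag n k) (mat_diag n m)) =
      det (?X * ?X - mat_diag n (\<lambda>j. [:- k j:]) * mat_diag n (\<lambda>j. [:- m j:]))"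
    unfolding char_poly_def by (simp add: det_four_block_mat[of _ n] mult.commute)
  also have "?X * ?X - mat_diag n (\<lambda>j. [:- k j:]) * mat_diag n (\<lambda>j. [:- m j:]) = ?D"
    unfolding mat_diag_diag by (rule eq_matI) (auto simp: mat_diag_def)
  also have "det ?D = prod_list (diag_mat ?D)"
    by (rule det_upper_triangular[of _ n]) (auto simp: mat_diag_def)
  also have "\<dots> = (\<Prod>j<n. [:- (k j * m j), 0, 1:])"
    by (simp add: prod_list_diag_prod mat_diag_def lessThan_atLeast0)
  finally show ?thesis .
qed

text \<open>Here \<open>H\<close> preserves each plane spanned by \<open>(p j, 0)\<close> and
  \<open>(0, q j)\<close> and acts on it by the 2 by 2 matrix with zero diagonal and off-diagonal
  entries \<open>k j\<close> and \<open>m j\<close>.\<close>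

locale block_eigenbasis = dual_bases +
  fixes K M :: "real mat" and k m :: "nat \<Rightarrow> real"
  assumes K: "K \<in> carrier_mat n n" "K\<^sup>T = K" and M: "M \<in> carrier_mat n n" "M\<^sup>T = M"
    and K_q: "j < n \<Longrightarrow> K *\<^sub>v q j = k j \<cdot>\<^sub>v p j"
    and M_p: "j < n \<Longrightarrow> M *\<^sub>v p j = m j \<cdot>\<^sub>v q j"
begin

definition H :: "real mat" where "H = block_H n K M"

lemma H_carrier: "H \<in> carrier_mat (n + n) (n + n)"
  unfolding H_def using K(1) M(1) by (rule block_H_carrier)

lemma H_mult_vec:
  assumes "v \<in> carrier_vec (n + n)"
  shows "H *\<^sub>v v = (K *\<^sub>v vec_last v n) @\<^sub>v (M *\<^sub>v vec_first v n)"
  using block_H_mult_append[OF K(1) M(1), of "vec_first v n" "vec_last v n"] assms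
  by (simp add: H_def)

text \<open>Symmetry moves \<open>K\<close> onto \<open>q j\<close> and \<open>M\<close> onto
  \<open>p j\<close>, where they act by scaling.\<close>

lemma coord_H:
  assumes j: "j < n" and v: "v \<in> carrier_vec (n + n)"
  shows "coord (True, j) (H *\<^sub>v v) = k j * coord (False, j) v"
    and "coord (False, j) (H *\<^sub>v v) = m j * coord (True, j) v"
proof -
  have "q j \<bullet> (K *\<^sub>v w) = k j * (p j \<bullet> w)" if "w \<in> carrier_vec n" for w
    using transpose_vec_mult_scalar[OF K(1) that q_carrier[OF j]] p_carrier[OF j] that
    by (simp add: K K_q[OF j])
  moreover have "p j \<bullet> (M *\<^sub>v w) = m j * (q j \<bullet> w)" if "w \<in> carrier_vec n" for w
    using transpose_vec_mult_scalar[OF M(1) that p_carrier[OF j]] q_carrier[OF j] that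
    by (simp add: M M_p[OF j])
  moreover have "K *\<^sub>v vec_last v n \<in> carrier_vec n" "M *\<^sub>v vec_first v n \<in> carrier_vec n"
    using K M by (auto intro: mult_mat_vec_carrier)
  ultimately show "coord (True, j) (H *\<^sub>v v) = k j * coord (False, j) v"
    and "coord (False, j) (H *\<^sub>v v) = m j * coord (True, j) v"
    by (simp_all add: coord_def H_mult_vec[OF v] vec_first_append vec_last_append[of _ n])
qed

lemma invariant_coord_space:
  assumes "C \<subseteq> {..<n}"
  shows "invariant_subspace (n + n) H (coord_space (UNIV \<times> C))"
proof -
  have "H *\<^sub>v v \<in> coord_space (UNIV \<times> C)" if v: "v \<in> coord_space (UNIV \<times> C)" for v
  proof -
    have "v \<in> carrier_vec (n + n)" using v by (simp add: coord_space_def)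
    moreover from this have "H *\<^sub>v v \<in> carrier_vec (n + n)"
      using H_carrier by (auto intro: mult_mat_vec_carrier)
    moreover have "coord (b, j) v = 0" if "j < n" "j \<notin> C" for b j
      using v that by (auto simp: coord_space_def J_iff)
    ultimately have "coord x (H *\<^sub>v v) = 0" if "x \<in> J - UNIV \<times> C" for x
      using that by (cases x; cases "fst x") (auto simp: coord_H J_iff)
    with \<open>H *\<^sub>v v \<in> carrier_vec (n + n)\<close> show ?thesis
      by (simp add: coord_space_def)
  qed
  then show ?thesis
    using subspace_coord_space[of "UNIV \<times> C"] assms
    by (auto simp: invariant_subspace_def J_def)
qed

text \<open>By \<open>coord_H\<close>, a kernel vector has no first-block coordinates, and its
  second-block coordinates are free exactly where \<open>k j = 0\<close>.\<close>

lemma kernel_dim_H: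
  assumes m: "\<And>j. j < n \<Longrightarrow> m j \<noteq> 0"
  shows "kernel_dim H = card {j. j < n \<and> k j = 0}"
proof -
  define S where "S = {False} \<times> {j. j < n \<and> k j = 0}"
  have S: "S \<subseteq> J" by (auto simp: S_def J_iff)
  interpret ker: kernel "n + n" "n + n" H
    by unfold_locales (rule H_carrier)
  have "mat_kernel H = coord_space S"
  proof -
    have "H *\<^sub>v v = 0\<^sub>v (n + n) \<longleftrightarrow> (\<forall>x\<in>J - S. coord x v = 0)" if v: "v \<in> carrier_vec (n + n)" for v
    proof -
      have "H *\<^sub>v v = 0\<^sub>v (n + n) \<longleftrightarrow> (\<forall>x\<in>J. coord x (H *\<^sub>v v) = 0)"
        using coord_eqI[of "H *\<^sub>v v" "0\<^sub>v (n + n)"] H_carrier v by (auto simp: coord_zero)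
      also have "\<dots> \<longleftrightarrow> (\<forall>j<n. k j * coord (False, j) v = 0 \<and> m j * coord (True, j) v = 0)"
        using v by (auto simp: J_def coord_H all_bool_eq)
      also have "\<dots> \<longleftrightarrow> (\<forall>x\<in>J - S. coord x v = 0)"
        using m by (auto simp: J_def S_def all_bool_eq) (metis (full_types))+
      finally show ?thesis .
    qed
    then show ?thesis
      using mat_kernel[OF H_carrier] by (auto simp: coord_space_def)
  qed
  then have sub: "e ` S \<subseteq> mat_kernel H" and gen: "vs.span (e ` S) = mat_kernel H"
    using span_e[OF S] vs.in_own_span[OF e_image_carrier[OF S]] by auto
  have "ker.basis (e ` S)"
    using sub gen lin_indpt_e[OF S] ker.span_same[OF sub] ker.lindep_same[OF sub]
    by (simp add: ker.Ker.basis_def)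
  moreover have fin: "finite S" using S finite_J finite_subset by blast
  ultimately have "kernel_dim H = card (e ` S)"
    using ker.Ker.dim_basis[of "e ` S"] by simp
  also have "\<dots> = card S"
    using inj_on_subset[OF inj_on_e S] by (rule card_image)
  finally show ?thesis by (simp add: S_def card_cartesian_product_singleton)
qed

section \<open>Similarity of \<open>H\<close> to a matrix with diagonal blocks, and its
  characteristic polynomial\<close>

lemma K_Q: "K * Q = P * mat_diag n k"
proof (rule eq_matI)
  fix i j assume "i < dim_row (P * mat_diag n k)" "j < dim_col (P * mat_diag n k)"
  then have ij: "i < n" "j < n" using P_carrier by (auto simp: mat_diag_def)
  have "(K * Q) $$ (i, j) = (K *\<^sub>v q j) $ i"
    using ij K(1) Q_carrier by (simp add: col_Q)
  also have "\<dots> = k j * p j $ i"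
    using ij carrier_vecD[OF p_carrier[OF ij(2)]] by (simp add: K_q)
  also have "p j $ i = P $$ (i, j)"
    using ij P_carrier by (simp flip: col_P)
  finally show "(K * Q) $$ (i, j) = (P * mat_diag n k) $$ (i, j)"
    using ij by (simp add: mat_diag_mult_right[OF P_carrier])
qed (use K P_carrier Q_carrier in \<open>auto simp: mat_diag_def\<close>)

text \<open>The hypotheses are invariant under exchanging \<open>p\<close> with \<open>q\<close>,
  \<open>K\<close> with \<open>M\<close> and \<open>k\<close> with \<open>m\<close>; thus
  \<open>M_P\<close> is an instance of \<open>K_Q\<close>.\<close>

lemma block_eigenbasis_swap: "block_eigenbasis n q p M K m k"
  using swap K M K_q M_p by (simp add: block_eigenbasis_def block_eigenbasis_axioms_def)

lemma M_P: "M * P = Q * mat_diag n m"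
proof -
  interpret sw: block_eigenbasis n q p M K m k by (rule block_eigenbasis_swap)
  have "dual_bases.P n q = Q" "dual_bases.Q n p = P"
    by (simp_all add: P_def Q_def sw.P_def sw.Q_def)
  then show ?thesis using sw.K_Q by simp
qed

text \<open>The block diagonal matrix of \<open>P\<close> and \<open>Q\<close> conjugates
  \<open>H\<close> to the case of diagonal blocks; its inverse is built from the transposes of
  \<open>Q\<close> and \<open>P\<close>.\<close>

lemma char_poly_H: "char_poly H = (\<Prod>j<n. [:- (k j * m j), 0, 1:])"
proof -
  let ?O = "0\<^sub>m n n" and ?B = "block_H n (mat_diag n k) (mat_diag n m)"
  let ?W = "four_block_mat P ?O ?O Q" and ?V = "four_block_mat Q\<^sup>T ?O ?O P\<^sup>T"
  interpret sw: dual_bases n q p by (rule swap)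
  have sw: "sw.P = Q" "sw.Q = P"
    by (simp_all add: P_def Q_def sw.P_def sw.Q_def)
  note [simp] = P_carrier Q_carrier K(1) M(1)
  have [simp]: "A * B \<in> carrier_mat n n" if "A \<in> carrier_mat n n" "B \<in> carrier_mat n n" for A B :: "real mat"
    using that by (rule mult_carrier_mat)
  have [simp]: "P * ?O = ?O" "Q * ?O = ?O" "P\<^sup>T * ?O = ?O" "Q\<^sup>T * ?O = ?O" "K * ?O = ?O" "M * ?O = ?O"
    by (rule right_mult_zero_mat, simp)+
  have [simp]: "?O * P = ?O" "?O * Q = ?O" "?O * P\<^sup>T = ?O" "?O * Q\<^sup>T = ?O"
    by (rule left_mult_zero_mat, simp)+
  have [simp]: "?O * mat_diag n f = ?O" for f :: "nat \<Rightarrow> real"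
    by (rule left_mult_zero_mat[OF mat_diag_dim])
  have WV: "?W * ?V = 1\<^sub>m (n + n)"
    using sw.P_mult_transpose_Q
    by (subst mult_four_block_mat[of _ n n _ n _ n _ _ n _ n]) (auto simp: P_mult_transpose_Q sw)
  have VW: "?V * ?W = 1\<^sub>m (n + n)"
    using sw.transpose_Q_mult_P
    by (subst mult_four_block_mat[of _ n n _ n _ n _ _ n _ n]) (auto simp: transpose_Q_mult_P sw)
  have W: "?W \<in> carrier_mat (n + n) (n + n)" "?V \<in> carrier_mat (n + n) (n + n)" "?B \<in> carrier_mat (n + n) (n + n)"
    by (auto simp: block_H_def)
  have "H * ?W = four_block_mat ?O (K * Q) (M * P) ?O"
    unfolding H_def block_H_def
    by (subst mult_four_block_mat[of _ n n _ n _ n _ _ n _ n]) auto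
  also have "\<dots> = ?W * ?B"
    unfolding K_Q M_P block_H_def
    by (subst mult_four_block_mat[of _ n n _ n _ n _ _ n _ n]) auto
  finally have HW: "H * ?W = ?W * ?B" .
  have "H = H * (?W * ?V)"
    unfolding WV by (rule right_mult_one_mat[symmetric]) (rule H_carrier)
  also have "\<dots> = H * ?W * ?V"
    by (rule assoc_mult_mat[symmetric]) (rule H_carrier W)+
  finally have H_eq: "H = ?W * ?B * ?V"
    unfolding HW .
  have "similar_mat H ?B"
    by (rule similar_matI[OF _ WV VW H_eq]) (use W H_carrier in simp)
  then show ?thesis
    by (simp add: char_poly_similar char_poly_block_H_diag)
qed

lemma order_char_poly_H:
  assumes "\<And>j. j < n \<Longrightarrow> k j * m j \<ge> 0" "\<mu> > 0"
  shows "Polynomial.order \<mu> (char_poly H) = card {j. j < n \<and> k j * m j = \<mu>\<^sup>2}"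
proof -
  have "Polynomial.order \<mu> (char_poly H) = (\<Sum>j<n. if k j * m j = \<mu>\<^sup>2 then 1 else 0)"
    unfolding char_poly_H using assms
    by (subst order_prod_sum) (auto simp: order_square_minus_const simp del: mult_minus_left intro!: sum.cong)
  also have "\<dots> = card {j. j < n \<and> k j * m j = \<mu>\<^sup>2}"
    by (simp add: sum.If_cases Int_def)
  finally show ?thesis .
qed

end

section \<open>The normalized eigenbasis\<close>

text \<open>This identifies the zero eigenvalues of a sorted nonnegative list with an initial
  segment of indices.\<close>

lemma downward_closed_eq_lessThan:
  fixes Z :: "nat set"
  assumes "finite Z" and down: "\<And>i j. j \<in> Z \<Longrightarrow> i \<le> j \<Longrightarrow> i \<in> Z"
  shows "Z = {..<card Z}"
proof (cases "Z = {}")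
  case False
  define a where "a = Max Z"
  have "Z = {..a}"
    unfolding a_def using \<open>finite Z\<close> down[OF Max_in[OF \<open>finite Z\<close> False]] by auto
  then show ?thesis
    by (simp add: lessThan_Suc_atMost)
qed simp

lemma is_direct_sum_cong:
  assumes "\<And>i. i \<in> I \<Longrightarrow> V i = W i"
  shows "is_direct_sum N I V \<longleftrightarrow> is_direct_sum N I W"
proof -
  have "(\<Pi>\<^sub>E i\<in>I. V i) = (\<Pi>\<^sub>E i\<in>I. W i)"
    using assms by (rule PiE_cong)
  then show ?thesis using assms by (simp add: is_direct_sum_def)
qed

text \<open>The scaling is dictated by the theorem: \<open>m j = 1\<close> on the zero part gives
  \<open>H (p j, 0) = (0, q j)\<close>, and \<open>m j = k j\<close> on the positive part makes
  \<open>(p j, q j)\<close> an eigenvector of \<open>H\<close> for \<open>k j\<close>.\<close>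

locale normalized_block_eigenbasis = block_eigenbasis +
  fixes r :: nat
  assumes r_le: "r \<le> n"
    and zero_part: "j < r \<Longrightarrow> k j = 0" "j < r \<Longrightarrow> m j = 1"
    and pos_part: "r \<le> j \<Longrightarrow> j < n \<Longrightarrow> k j > 0" "r \<le> j \<Longrightarrow> j < n \<Longrightarrow> m j = k j"
    and mono: "i \<le> j \<Longrightarrow> j < n \<Longrightarrow> k i \<le> k j"
begin

definition x0 :: "nat \<Rightarrow> real vec" where "x0 i = q (i - 1)"
definition y0 :: "nat \<Rightarrow> real vec" where "y0 i = p (i - 1)"
definition x :: "nat \<Rightarrow> real vec" where "x i = q (r + i - 1)"
definition y :: "nat \<Rightarrow> real vec" where "y i = p (r + i - 1)"
definition lam :: "nat \<Rightarrow> real" where "lam i = k (r + i - 1)"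

text \<open>The set \<open>C i\<close> holds the 0-based basis indices that make up the
  \<open>i\<close>-th subspace; the shift \<open>r + i - 1\<close> accounts for families counted
  from 1.\<close>

definition C :: "nat \<Rightarrow> nat set" where
  "C i = (if i = 0 then {..<r} else {r + i - 1})"

lemma C_subset: "i \<in> {0..n - r} \<Longrightarrow> C i \<subseteq> {..<n}"
  using r_le by (auto simp: C_def)

lemma C_disjoint: "i \<noteq> j \<Longrightarrow> C i \<inter> C j = {}"
  by (auto simp: C_def)

lemma C_cover: "j < n \<Longrightarrow> j \<in> C (if j < r then 0 else j + 1 - r)"
  by (auto simp: C_def)

text \<open>After reindexing, the generators are the \<open>e\<close> vectors over
  \<open>UNIV \<times> C i\<close>, so \<open>span_e\<close> makes the results on coordinate spaces
  available.\<close>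

lemma V_space_eq:
  assumes "i \<in> {0..n - r}"
  shows "V_space n r x0 y0 x y i = coord_space (UNIV \<times> C i)"
proof -
  have sub: "UNIV \<times> C i \<subseteq> J" using C_subset[OF assms] by (auto simp: J_def)
  have "e ` (UNIV \<times> C i) = (\<lambda>j. 0\<^sub>v n @\<^sub>v q j) ` C i \<union> (\<lambda>j. p j @\<^sub>v 0\<^sub>v n) ` C i"
  proof -
    have "(UNIV :: bool set) \<times> C i = Pair False ` C i \<union> Pair True ` C i"
      by (auto simp: UNIV_bool)
    then show ?thesis
      by (simp only: image_Un image_image) (simp add: e_def)
  qed
  moreover have shift: "(\<lambda>j. f (j - 1)) ` {1..r} = f ` {..<r}" for f :: "nat \<Rightarrow> real vec"
    unfolding image_Suc_lessThan[symmetric] image_image by simp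
  moreover note shift[of "\<lambda>j. 0\<^sub>v n @\<^sub>v q j"] shift[of "\<lambda>j. p j @\<^sub>v 0\<^sub>v n"]
  ultimately have "V_space n r x0 y0 x y i = span_vec (n + n) (e ` (UNIV \<times> C i))"
    unfolding V_space_def C_def x0_def y0_def x_def y_def by (cases "i = 0") (simp_all add: insert_commute)
  then show ?thesis by (simp only: span_e[OF sub])
qed

lemma direct_sum_V_space: "is_direct_sum (n + n) {0..n - r} (V_space n r x0 y0 x y)"
proof -
  have "is_direct_sum (n + n) {0..n - r} (\<lambda>i. coord_space (UNIV \<times> C i))"
  proof (rule is_direct_sum_coord_space)
    fix z assume z: "z \<in> J"
    define i where "i = (if snd z < r then 0 else snd z + 1 - r)"
    have "i \<in> {0..n - r}" "z \<in> UNIV \<times> C i"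
      using z C_cover[of "snd z"] by (cases z; auto simp: i_def J_iff)+
    moreover have "l = i" if "z \<in> UNIV \<times> C l" for l
      using that \<open>z \<in> UNIV \<times> C i\<close> C_disjoint[of l i] by auto
    ultimately show "\<exists>!i. i \<in> {0..n - r} \<and> z \<in> UNIV \<times> C i" by blast
  next
    show "UNIV \<times> C i \<subseteq> J" if "i \<in> {0..n - r}" for i
      using C_subset[OF that] by (auto simp: J_def)
  qed simp
  then show ?thesis
    by (simp only: is_direct_sum_cong[OF V_space_eq])
qed

text \<open>The coefficients \<open>(a, b)\<close> equal to \<open>(0, 1)\<close>,
  \<open>(1, 0)\<close>, \<open>(1, 1)\<close> and \<open>(-1, 1)\<close> give the four displayed
  equations for \<open>H\<close>.\<close>

lemma H_mult_append:
  assumes "i < n" "j < n"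
  shows "H *\<^sub>v ((a \<cdot>\<^sub>v p i) @\<^sub>v (b \<cdot>\<^sub>v q j)) = (b * k j) \<cdot>\<^sub>v p j @\<^sub>v (a * m i) \<cdot>\<^sub>v q i"
  using assms p_carrier q_carrier block_H_mult_append[OF K(1) M(1), of "a \<cdot>\<^sub>v p i" "b \<cdot>\<^sub>v q j"]
  by (simp add: H_def mult_mat_vec[OF K(1)] mult_mat_vec[OF M(1)] K_q M_p smult_smult_assoc)

lemma H_zero_part:
  assumes "i \<in> {1..r}"
  shows "H *\<^sub>v (0\<^sub>v n @\<^sub>v x0 i) = 0\<^sub>v n @\<^sub>v 0\<^sub>v n"
    and "H *\<^sub>v (y0 i @\<^sub>v 0\<^sub>v n) = 0\<^sub>v n @\<^sub>v x0 i"
proof -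
  obtain j where i: "i = Suc j" and j: "j < r" "j < n"
    using assms r_le by (cases i) auto
  have zero: "0 \<cdot>\<^sub>v p j = 0\<^sub>v n" "0 \<cdot>\<^sub>v q j = 0\<^sub>v n"
    using p_carrier[OF j(2)] q_carrier[OF j(2)] by auto
  show "H *\<^sub>v (0\<^sub>v n @\<^sub>v x0 i) = 0\<^sub>v n @\<^sub>v 0\<^sub>v n"
    using H_mult_append[OF j(2) j(2), of 0 1] j by (simp add: i x0_def zero_part zero)
  show "H *\<^sub>v (y0 i @\<^sub>v 0\<^sub>v n) = 0\<^sub>v n @\<^sub>v x0 i"
    using H_mult_append[OF j(2) j(2), of 1 0] j by (simp add: i x0_def y0_def zero_part zero)
qed

lemma smult_append_vec: "c \<cdot>\<^sub>v (v @\<^sub>v w) = c \<cdot>\<^sub>v v @\<^sub>v c \<cdot>\<^sub>v w" for c :: real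
  by (intro eq_vecI) auto

lemma H_pos_part:
  assumes "i \<in> {1..n - r}"
  shows "H *\<^sub>v (y i @\<^sub>v x i) = lam i \<cdot>\<^sub>v (y i @\<^sub>v x i)"
    and "H *\<^sub>v (- y i @\<^sub>v x i) = (- lam i) \<cdot>\<^sub>v (- y i @\<^sub>v x i)"
proof -
  have i: "r + i - 1 < n" "r \<le> r + i - 1" using assms by auto
  show "H *\<^sub>v (y i @\<^sub>v x i) = lam i \<cdot>\<^sub>v (y i @\<^sub>v x i)"
    using H_mult_append[OF i(1) i(1), of 1 1] pos_part(2)[OF i(2,1)]
    by (simp add: smult_append_vec x_def y_def lam_def)
  have neg: "- v = (- 1) \<cdot>\<^sub>v v" for v :: "real vec"
    by (intro eq_vecI) auto
  show "H *\<^sub>v (- y i @\<^sub>v x i) = (- lam i) \<cdot>\<^sub>v (- y i @\<^sub>v x i)"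
    using H_mult_append[OF i(1) i(1), of "- 1" 1] pos_part(2)[OF i(2,1)]
    by (simp add: smult_append_vec x_def y_def lam_def neg smult_smult_assoc)
qed

text \<open>The product \<open>k j * m j\<close> is 0 on the zero part and \<open>(k j)^2\<close> on
  the positive part, so it equals the square of \<open>\<mu>\<close> exactly when
  \<open>r \<le> j\<close> and \<open>k j = \<mu>\<close>. The index shift is a bijection.\<close>

lemma order_char_poly_eq_card:
  assumes \<mu>: "\<mu> > 0"
  shows "Polynomial.order \<mu> (char_poly H) = card {i \<in> {1..n - r}. lam i = \<mu>}"
proof -
  have nonneg: "k j * m j \<ge> 0" if "j < n" for j
    using that zero_part[of j] pos_part[of j] by (cases "j < r") auto
  have eq: "k j * m j = \<mu>\<^sup>2 \<longleftrightarrow> r \<le> j \<and> k j = \<mu>" if "j < n" for j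
  proof (cases "j < r")
    case False
    then have "k j > 0" "k j * m j = (k j)\<^sup>2"
      using that pos_part[of j] by (auto simp: power2_eq_square)
    then show ?thesis using \<mu> False power2_eq_iff_nonneg[of "k j" \<mu>] by auto
  qed (use \<mu> zero_part in auto)
  have "{j. j < n \<and> k j * m j = \<mu>\<^sup>2} = {j. r \<le> j \<and> j < n \<and> k j = \<mu>}"
    using eq by auto
  moreover have "bij_betw (\<lambda>i. r + i - 1) {i \<in> {1..n - r}. lam i = \<mu>} {j. r \<le> j \<and> j < n \<and> k j = \<mu>}"
    by (rule bij_betw_byWitness[where f' = "\<lambda>j. j + 1 - r"]) (auto simp: lam_def)
  ultimately show ?thesis
    using order_char_poly_H[OF nonneg \<mu>] by (simp add: bij_betw_same_card)
qed

text \<open>A positive number is an eigenvalue iff its order as a root is nonzero, and that order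
  counts its occurrences in \<open>lam\<close>.\<close>

lemma lists_pos_eigenvalues_lam: "lists_pos_eigenvalues H (n - r) lam"
proof -
  have "lam i > 0" if "i \<in> {1..n - r}" for i
    using that by (auto simp: lam_def intro!: pos_part)
  moreover have "eigenvalue H \<mu> \<longleftrightarrow> \<mu> \<in> lam ` {1..n - r}" if "\<mu> > 0" for \<mu>
  proof -
    have "char_poly H \<noteq> 0"
      using degree_monic_char_poly[OF H_carrier] by auto
    then have "eigenvalue H \<mu> \<longleftrightarrow> card {i \<in> {1..n - r}. lam i = \<mu>} \<noteq> 0"
      using order_char_poly_eq_card[OF that]
      by (simp add: eigenvalue_root_char_poly[OF H_carrier] order_root)
    then show ?thesis by auto
  qed
  ultimately have "lam ` {1..n - r} = {\<mu>. eigenvalue H \<mu> \<and> 0 < \<mu>}" by auto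
  moreover have "mono_on {1..n - r} lam"
    by (auto simp: mono_on_def lam_def intro!: mono)
  ultimately show ?thesis
    using order_char_poly_eq_card by (simp add: lists_pos_eigenvalues_def)
qed

lemma x0_y0_carrier:
  assumes "i \<in> {1..r}"
  shows "x0 i \<in> carrier_vec n" "y0 i \<in> carrier_vec n"
proof -
  have "i - 1 < n" using assms r_le by auto
  then show "x0 i \<in> carrier_vec n" "y0 i \<in> carrier_vec n"
    unfolding x0_def y0_def using q_carrier p_carrier by blast+
qed

lemma x_y_carrier:
  assumes "i \<in> {1..n - r}"
  shows "x i \<in> carrier_vec n" "y i \<in> carrier_vec n"
proof -
  have "r + i - 1 < n" using assms by auto
  then show "x i \<in> carrier_vec n" "y i \<in> carrier_vec n"
    unfolding x_def y_def using q_carrier p_carrier by blast+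
qed

lemma invariant_V_space:
  assumes "i \<in> {0..n - r}"
  shows "invariant_subspace (n + n) H (V_space n r x0 y0 x y i)"
  unfolding V_space_eq[OF assms] using C_subset[OF assms] by (rule invariant_coord_space)

lemma biorthogonal_V_space:
  assumes "i \<in> {0..n - r}" "j \<in> {0..n - r}" "i \<noteq> j"
  shows "biorthogonal_spaces n (V_space n r x0 y0 x y i) (V_space n r x0 y0 x y j)"
  unfolding V_space_eq[OF assms(1)] V_space_eq[OF assms(2)]
  by (rule biorthogonal_coord_space) (rule C_disjoint[OF assms(3)])

lemma cols_mat_eq: "cols_mat n r (n - r) x0 x = Q" "cols_mat n r (n - r) y0 y = P"
proof -
  have "map (\<lambda>i. f (i - 1)) [1..<Suc r] @ map (\<lambda>i. f (r + i - 1)) [1..<Suc (n - r)] = map f [0..<n]"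
    for f :: "nat \<Rightarrow> real vec"
  proof (rule nth_equalityI)
    fix i assume "i < length (map (\<lambda>i. f (i - 1)) [1..<Suc r] @ map (\<lambda>i. f (r + i - 1)) [1..<Suc (n - r)])"
    then have "i < n" using r_le by (simp del: upt_Suc)
    then show "(map (\<lambda>i. f (i - 1)) [1..<Suc r] @ map (\<lambda>i. f (r + i - 1)) [1..<Suc (n - r)]) ! i = map f [0..<n] ! i"
      using diff_less_mono[of i n r] by (cases "i < r") (simp_all add: nth_append del: upt_Suc)
  qed (use r_le in \<open>simp del: upt_Suc\<close>)
  then show "cols_mat n r (n - r) x0 x = Q" "cols_mat n r (n - r) y0 y = P"
    unfolding cols_mat_def P_def Q_def x0_def[abs_def] x_def[abs_def] y0_def[abs_def] y_def[abs_def]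
    by (simp_all only:)
qed

end

text \<open>For an \<open>M\<close>-orthonormal eigenbasis \<open>u\<close> of \<open>K M\<close>,
  the families \<open>u\<close> and \<open>M u\<close> are dual. Sorting gives the order, and
  scaling by \<open>c\<close> and \<open>1 / c\<close> keeps duality while changing the pair of
  factors from \<open>\<mu>\<close> and 1 to \<open>\<mu> / c^2\<close> and
  \<open>c^2\<close>.\<close>

lemma normalized_block_eigenbasis_exists:
  fixes K M :: "real mat"
  assumes K: "K \<in> carrier_mat n n" "K\<^sup>T = K" "pos_semidef n K"
    and M: "M \<in> carrier_mat n n" "M\<^sup>T = M" "pos_def n M"
  shows "\<exists>p q k m. normalized_block_eigenbasis n p q K M k m (kernel_dim (block_H n K M))"
proof -
  have K_sym: "(K *\<^sub>v v) \<bullet> w = v \<bullet> (K *\<^sub>v w)"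
    and M_sym: "(M *\<^sub>v v) \<bullet> w = v \<bullet> (M *\<^sub>v w)"
    if "v \<in> carrier_vec n" "w \<in> carrier_vec n" for v w
    using transpose_vec_mult_scalar[OF K(1) that(2,1)] transpose_vec_mult_scalar[OF M(1) that(2,1)] K(2) M(2)
    by simp_all
  have KM: "K * M \<in> carrier_mat n n" using K M by simp
  have mult: "K *\<^sub>v v \<in> carrier_vec n" "M *\<^sub>v v \<in> carrier_vec n" if "v \<in> carrier_vec n" for v
    using that K M by (auto intro: mult_mat_vec_carrier)
  \<comment> \<open>Both sides equal the bilinear form of the symmetric matrix
    \<open>M K M\<close>.\<close>
  have selfadj: "v \<bullet> (M *\<^sub>v ((K * M) *\<^sub>v w)) = ((K * M) *\<^sub>v v) \<bullet> (M *\<^sub>v w)"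
    if "v \<in> carrier_vec n" "w \<in> carrier_vec n" for v w
    using that K(1) M(1) M_sym[OF that(1), of "K *\<^sub>v (M *\<^sub>v w)"] K_sym[of "M *\<^sub>v v" "M *\<^sub>v w"]
    by (simp add: mult)
  have "\<exists>(u :: nat \<Rightarrow> real vec) \<mu>. \<forall>i<n. u i \<in> carrier_vec n \<and> (K * M) *\<^sub>v u i = \<mu> i \<cdot>\<^sub>v u i \<and>
      (\<forall>j<n. (M *\<^sub>v u i) \<bullet> u j = (if i = j then 1 else 0))"
    by (rule selfadjoint_orthonormal_family[OF KM M _ order_refl]) (rule selfadj)
  then obtain u0 :: "nat \<Rightarrow> real vec" and \<mu>0 where
    basis: "\<forall>i<n. u0 i \<in> carrier_vec n \<and> (K * M) *\<^sub>v u0 i = \<mu>0 i \<cdot>\<^sub>v u0 i \<and>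
      (\<forall>j<n. (M *\<^sub>v u0 i) \<bullet> u0 j = (if i = j then 1 else 0))"
    by (elim exE)
  then have u0: "\<And>i. i < n \<Longrightarrow> u0 i \<in> carrier_vec n"
    and eig0: "\<And>i. i < n \<Longrightarrow> (K * M) *\<^sub>v u0 i = \<mu>0 i \<cdot>\<^sub>v u0 i"
    and orth0: "\<And>i j. i < n \<Longrightarrow> j < n \<Longrightarrow> (M *\<^sub>v u0 i) \<bullet> u0 j = (if i = j then 1 else 0)"
    by simp_all
  define js where "js = sort_key \<mu>0 [0..<n]"
  have js: "length js = n" "distinct js" "set js = {..<n}" "sorted (map \<mu>0 js)"
    by (simp_all add: js_def lessThan_atLeast0)
  have js_less: "js ! j < n" if "j < n" for j
    using js(1,3) nth_mem[of j js] that by auto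
  define u \<mu> where "u j = u0 (js ! j)" and "\<mu> j = \<mu>0 (js ! j)" for j
  have u: "u j \<in> carrier_vec n" and eig: "K *\<^sub>v (M *\<^sub>v u j) = \<mu> j \<cdot>\<^sub>v u j" if "j < n" for j
    using u0 eig0[OF js_less[OF that]] js_less[OF that] K(1) M(1) by (auto simp: u_def \<mu>_def)
  have orth: "(M *\<^sub>v u i) \<bullet> u j = (if i = j then 1 else 0)" if "i < n" "j < n" for i j
    using orth0[OF js_less js_less, OF that] that js by (simp add: u_def nth_eq_iff_index_eq)
  have mono: "\<mu> i \<le> \<mu> j" if "i \<le> j" "j < n" for i j
    using sorted_nth_mono[OF js(4) that(1)] that js(1) by (simp add: \<mu>_def)
  have nonneg: "\<mu> j \<ge> 0" if "j < n" for j
  proof -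
    \<comment> \<open>Testing \<open>K\<close> on \<open>M u j\<close> returns the eigenvalue,
      because \<open>u j\<close> is \<open>M\<close>-normalized.\<close>
    have "0 \<le> (M *\<^sub>v u j) \<bullet> (K *\<^sub>v (M *\<^sub>v u j))"
      using K(3) mult(2)[OF u[OF that]] by (simp add: pos_semidef_def)
    also have "\<dots> = \<mu> j"
      using orth[OF that that] mult[OF u[OF that]] u[OF that] by (simp add: eig[OF that])
    finally show ?thesis .
  qed
  \<comment> \<open>The unscaled basis, with second factor 1, already shows that the kernel
    dimension counts the zero eigenvalues.\<close>
  interpret raw: block_eigenbasis n u "\<lambda>j. M *\<^sub>v u j" K M \<mu> "\<lambda>_. 1"
    by unfold_locales (use u mult orth K M eig in auto)
  define r where "r = kernel_dim (block_H n K M)"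
  have "r = card {j. j < n \<and> \<mu> j = 0}"
    using raw.kernel_dim_H by (simp add: r_def raw.H_def)
  moreover have "{j. j < n \<and> \<mu> j = 0} = {..<card {j. j < n \<and> \<mu> j = 0}}"
  proof (rule downward_closed_eq_lessThan)
    fix i j assume "j \<in> {j. j < n \<and> \<mu> j = 0}" "i \<le> j"
    then show "i \<in> {j. j < n \<and> \<mu> j = 0}"
      using mono[of i j] nonneg[of i] by auto
  qed simp
  ultimately have zero: "{j. j < n \<and> \<mu> j = 0} = {..<r}" by simp
  have r_le: "r \<le> n"
  proof (rule ccontr)
    assume "\<not> r \<le> n"
    then have "n \<in> {..<r}" by simp
    then show False unfolding zero[symmetric] by simp
  qed
  have \<mu>_zero: "\<mu> j = 0" if "j < r" for j using zero that by auto
  have \<mu>_pos: "\<mu> j > 0" if "r \<le> j" "j < n" for j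
  proof -
    have "j \<notin> {j. j < n \<and> \<mu> j = 0}" unfolding zero using that by simp
    with nonneg[of j] that show ?thesis by auto
  qed
  \<comment> \<open>On the positive part \<open>c^4 = \<mu>\<close> balances the two factors to
    \<open>sqrt \<mu>\<close>; on the zero part the value 1 avoids division by zero and gives the
    required factor 1.\<close>
  define c where "c j = (if j < r then 1 else sqrt (sqrt (\<mu> j)))" for j
  have c_pos: "c j > 0" if "j < n" for j
    using \<mu>_pos[of j] that by (simp add: c_def)
  have c_sq: "(c j)\<^sup>2 = sqrt (\<mu> j)" if "r \<le> j" "j < n" for j
    using \<mu>_pos[OF that] that by (auto simp: c_def)
  \<comment> \<open>The formula also covers the zero part, where both sides vanish, so the ordering
    follows from monotonicity of the square root.\<close>
  have k_eq: "\<mu> j / (c j)\<^sup>2 = sqrt (\<mu> j)" if "j < n" for j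
  proof (cases "j < r")
    case False
    then show ?thesis
      using that \<mu>_pos[of j] c_sq[of j] by (simp add: real_div_sqrt)
  qed (simp add: \<mu>_zero)
  have "normalized_block_eigenbasis n (\<lambda>j. c j \<cdot>\<^sub>v u j) (\<lambda>j. (1 / c j) \<cdot>\<^sub>v (M *\<^sub>v u j)) K M
      (\<lambda>j. \<mu> j / (c j)\<^sup>2) (\<lambda>j. (c j)\<^sup>2) r"
  proof (unfold_locales; (rule K M r_le)?)
    fix i j assume ij: "i < n" "j < n"
    have "((1 / c i) \<cdot>\<^sub>v (M *\<^sub>v u i)) \<bullet> (c j \<cdot>\<^sub>v u j) = 1 / c i * (c j * ((M *\<^sub>v u i) \<bullet> u j))"
      using u[OF ij(2)] mult(2)[OF u[OF ij(1)]]
      by (simp add: smult_scalar_prod_distrib[of _ n] scalar_prod_smult_distrib[of _ n])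
    then show "((1 / c i) \<cdot>\<^sub>v (M *\<^sub>v u i)) \<bullet> (c j \<cdot>\<^sub>v u j) = (if i = j then 1 else 0)"
      using c_pos[OF ij(1)] c_pos[OF ij(2)] by (simp add: orth[OF ij])
  next
    fix j assume j: "j < n"
    then show "c j \<cdot>\<^sub>v u j \<in> carrier_vec n" "(1 / c j) \<cdot>\<^sub>v (M *\<^sub>v u j) \<in> carrier_vec n"
      using u mult by auto
    show "K *\<^sub>v ((1 / c j) \<cdot>\<^sub>v (M *\<^sub>v u j)) = (\<mu> j / (c j)\<^sup>2) \<cdot>\<^sub>v (c j \<cdot>\<^sub>v u j)"
      using j c_pos[OF j] u mult by (simp add: mult_mat_vec[OF K(1)] eig smult_smult_assoc power2_eq_square)
    show "M *\<^sub>v (c j \<cdot>\<^sub>v u j) = (c j)\<^sup>2 \<cdot>\<^sub>v ((1 / c j) \<cdot>\<^sub>v (M *\<^sub>v u j))"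
      using j c_pos[OF j] u by (simp add: mult_mat_vec[OF M(1)] smult_smult_assoc power2_eq_square)
  next
    fix j assume "j < r"
    then show "\<mu> j / (c j)\<^sup>2 = 0" "(c j)\<^sup>2 = 1" by (simp_all add: \<mu>_zero c_def)
  next
    fix j assume j: "r \<le> j" "j < n"
    show "\<mu> j / (c j)\<^sup>2 > 0"
      using \<mu>_pos[OF j] unfolding k_eq[OF j(2)] by simp
    show "(c j)\<^sup>2 = \<mu> j / (c j)\<^sup>2"
      unfolding k_eq[OF j(2)] by (rule c_sq[OF j])
  next
    fix i j :: nat assume ij: "i \<le> j" "j < n"
    then have "i < n" by simp
    show "\<mu> i / (c i)\<^sup>2 \<le> \<mu> j / (c j)\<^sup>2"
      unfolding k_eq[OF ij(2)] k_eq[OF \<open>i < n\<close>] using mono[OF ij] by simp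
  qed
  then show ?thesis unfolding r_def by blast
qed

theorem theorem2p8:
  fixes n r :: nat and K M H :: "real mat"
  assumes K: "K \<in> carrier_mat n n" "K\<^sup>T = K" "pos_semidef n K"
    and M: "M \<in> carrier_mat n n" "M\<^sup>T = M" "pos_def n M"
    and H: "H = block_H n K M"
    and r: "kernel_dim H = r" "r > 0"
  shows "\<exists>(x0 :: nat \<Rightarrow> real vec) (y0 :: nat \<Rightarrow> real vec)
           (x :: nat \<Rightarrow> real vec) (y :: nat \<Rightarrow> real vec) (lam :: nat \<Rightarrow> real).
     r \<le> n \<and>
     (\<forall>i \<in> {1..r}. x0 i \<in> carrier_vec n \<and> y0 i \<in> carrier_vec n) \<and>
     (\<forall>i \<in> {1..n - r}. x i \<in> carrier_vec n \<and> y i \<in> carrier_vec n) \<and>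
     is_direct_sum (n + n) {0..n - r} (V_space n r x0 y0 x y) \<and>
     (\<forall>i \<in> {0..n - r}. invariant_subspace (n + n) H (V_space n r x0 y0 x y i)) \<and>
     (\<forall>i \<in> {1..r}.
        H *\<^sub>v (0\<^sub>v n @\<^sub>v x0 i) = 0\<^sub>v n @\<^sub>v 0\<^sub>v n \<and>
        H *\<^sub>v (y0 i @\<^sub>v 0\<^sub>v n) = 0\<^sub>v n @\<^sub>v x0 i) \<and>
     (\<forall>i \<in> {1..n - r}.
        H *\<^sub>v (y i @\<^sub>v x i) = lam i \<cdot>\<^sub>v (y i @\<^sub>v x i) \<and>
        H *\<^sub>v (- y i @\<^sub>v x i) = (- lam i) \<cdot>\<^sub>v (- y i @\<^sub>v x i)) \<and>
     lists_pos_eigenvalues H (n - r) lam \<and>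
     (cols_mat n r (n - r) x0 x)\<^sup>T * cols_mat n r (n - r) y0 y = 1\<^sub>m n \<and>
     (\<forall>i \<in> {0..n - r}. \<forall>j \<in> {0..n - r}. i \<noteq> j \<longrightarrow>
        biorthogonal_spaces n (V_space n r x0 y0 x y i) (V_space n r x0 y0 x y j))"
proof -
  obtain p q k m where "normalized_block_eigenbasis n p q K M k m r"
    using normalized_block_eigenbasis_exists[OF K M] H r by auto
  then interpret B: normalized_block_eigenbasis n p q K M k m r .
  have HB: "H = B.H" by (simp add: H B.H_def)
  show ?thesis
    unfolding HB
    by (rule exI[of _ B.x0], rule exI[of _ B.y0], rule exI[of _ B.x], rule exI[of _ B.y], rule exI[of _ B.lam])
      (intro conjI ballI impI B.r_le B.direct_sum_V_space B.invariant_V_space B.H_zero_part B.H_pos_part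
        B.lists_pos_eigenvalues_lam B.biorthogonal_V_space B.x0_y0_carrier B.x_y_carrier;
        simp add: B.cols_mat_eq B.transpose_Q_mult_P)
qed

end
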